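(* Let $n\ge 2$, and for $\boldsymbol{\lambda}\in\mathbb{C}^n$ let $\nabla_{\boldsymbol{\lambda}}=d+A_{\boldsymbol{\lambda}}$ be the meromorphic connection on $\mathcal{O}_{\mathbb{P}^n}\oplus\mathcal{O}_{\mathbb{P}^n}$ over the complex projective space $\mathbb{P}^n$ given in the context. Via a generically finite Galois morphism $g\colon\mathbb{P}^n\to\mathbb{P}^n$, for each $\boldsymbol{\lambda}\in\mathbb{C}^n$, the pull-back connection $g^*\nabla_{\boldsymbol{\lambda}}$ on the trivial bundle is projectively birationally equivalent to a split connection of the form $$d+\begin{pmatrix}\omega&0\\0&-\omega\end{pmatrix}$$ with $\omega$ a rational closed $1$-form on $\mathbb{P}^n$.
   Context: Two connections $(E,\nabla)$, $(E',\nabla')$ are birationally equivalent if there is a birational bundle transformation $E\dashrightarrow E'$ conjugating the two operators $\nabla$ and $\nabla'$. They are projectively equivalent if the induced $\mathbb{P}^1$-bundles coincide, $\mathbb{P}(E)=\mathbb{P}(E')$, and moreover $\nabla,\nabla'$ induce the same projective connection $\mathbb{P}(\nabla)=\mathbb{P}(\nabla')$. "Projectively birationally equivalent" combines the two: there is a birational bundle transformation $\mathbb{P}(E)\dashrightarrow\mathbb{P}(E')$ conjugating the projective connections $\mathbb{P}(\nabla)$ and $\mathbb{P}(\nabla')$. Definition of $\nabla_{\boldsymbol{\lambda}}$. Let $[x:y:z_1:\dots:z_{n-2}:t]$ be homogeneous coordinates of $\mathbb{P}^n$, and $f(x,y,t):=x^2+y^2+t^2-2(xy+yt+tx)$. For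 $\boldsymbol{\lambda}=(\lambda_0,\dots,\lambda_{n-1})\in\mathbb{C}^n$ define rational $1$-forms on $\mathbb{P}^n$, written in the affine coordinates $[x:y:z_1:\dots:z_{n-2}:1]$, for $i=1,\dots,n-2$: $$\alpha_0:=-\frac{(2\lambda_0+\lambda_1)dx-(2\lambda_1+\lambda_0)dy}{2}-\frac{\lambda_1(y-1)}{2}\frac{dx}{x}+\frac{\lambda_0(x-1)}{2}\frac{dy}{y},$$ $$\alpha_1:=-\frac14\frac{df(x,y,1)}{f(x,y,1)},\qquad \alpha_2:=-\frac{\alpha_0}{f(x,y,1)},$$ $$\alpha_0^i:=\lambda_{i+1}\left(dz_i-\frac{z_i\,d(f(x,y,1)-z_i^2)}{2(f(x,y,1)-z_i^2)}\right),\qquad \alpha_2^i:=-\frac{\alpha_0^i}{f(x,y,1)}.$$ Set $$\mathcal{A}_{11}:=(x-1)\alpha_2+\alpha_1+\frac12\frac{dy}{y},\quad \mathcal{A}_{12}:=\frac{dx+(x-1)^2\alpha_2+2(x-1)\alpha_1+\alpha_0}{y},\quad \mathcal{A}_{21}:=y\alpha_2,$$ $$\mathcal{A}^i_{11}:=(x-1)\alpha_2^i,\quad \mathcal{A}^i_{12}:=\frac{(x-1)^2\alpha_2^i+\alpha_0^i}{y},\quad \mathcal{A}^i_{21}:=y\alpha^i_2,$$ $$A_{\boldsymbol{\lambda}}:=\begin{pmatrix}\mathcal{A}_{11}&\mathcal{A}_{12}\\-\mathcal{A}_{21}&-\mathcal{A}_{11}\end{pmatrix}+\sum_{i=1}^{n-2}\begin{pmatrix}\mathcal{A}^i_{11}&\mathcal{A}^i_{12}\\-\mathcal{A}^i_{21}&-\mathcal{A}^i_{11}\end{pmatrix},\qquad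 \nabla_{\boldsymbol{\lambda}}:=d+A_{\boldsymbol{\lambda}}.$$ (For $n=2$ there are no $z_i$ and the sum is empty.)
   Formalization: The morphism g: P^n → P^n is taken to be a dominant rational map, with base points allowed; an everywhere regular g cannot exist for general λ, since it would have to factor through the double cover s² = f(x,y,t), which for n = 2 is P¹×P¹. *)

theory Defs
  imports
    "HOL-Analysis.Determinants"
    "HOL-Computational_Algebra.Fraction_Field"
    "HOL-Library.Poly_Mapping"
begin

section \<open>Polynomials and rational functions over the complex numbers\<close>

text \<open>
  The ambient polynomial ring has the countably many variables \<open>X\<^sub>0, X\<^sub>1, \<dots>\<close>, so that the dimension
  can be a natural number; the homogeneous coordinates of \<open>\<P>\<^sup>n\<close> are \<open>X\<^sub>0, \<dots>, X\<^sub>n\<close>.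
  A monomial is its exponent function.
\<close>

type_synonym cpoly = "(nat \<Rightarrow>\<^sub>0 nat) \<Rightarrow>\<^sub>0 complex"
type_synonym crat = "cpoly fract"

definition rconst :: "complex \<Rightarrow> crat" where
  "rconst c = Fract (Poly_Mapping.single 0 c) 1"

definition rvar :: "nat \<Rightarrow> crat" where
  "rvar i = Fract (Poly_Mapping.single (Poly_Mapping.single i 1) 1) 1"

lemma cpoly_induct [case_names zero single add]:
  fixes p :: cpoly
  assumes "P 0" and "\<And>m c. P (Poly_Mapping.single m c)"
    and "\<And>p q. P p \<Longrightarrow> P q \<Longrightarrow> P (p + q)"
  shows "P p"
proof -
  have eq: "p = (\<Sum>m\<in>Poly_Mapping.keys p. Poly_Mapping.single m (Poly_Mapping.lookup p m))"
    by (rule poly_mapping_eqI)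
      (auto simp: lookup_sum lookup_single when_def in_keys_iff)
  have "P (\<Sum>m\<in>A. Poly_Mapping.single m (Poly_Mapping.lookup p m))" if "finite A" for A
    using that by induction (auto intro: assms)
  then show ?thesis by (subst eq) simp
qed

subsection \<open>Partial derivatives\<close>

definition pd_poly :: "nat \<Rightarrow> cpoly \<Rightarrow> cpoly" where
  "pd_poly j p = (\<Sum>m\<in>Poly_Mapping.keys p.
     Poly_Mapping.single (m - Poly_Mapping.single j 1)
       (of_nat (Poly_Mapping.lookup m j) * Poly_Mapping.lookup p m))"

lemma pd_poly_add: "pd_poly j (p + q) = pd_poly j p + pd_poly j q"
  unfolding pd_poly_def
  by (rule setsum_keys_plus_distrib) (auto simp: single_add distrib_left)

lemma pd_poly_single:
  "pd_poly j (Poly_Mapping.single m c) =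
     Poly_Mapping.single (m - Poly_Mapping.single j 1) (of_nat (Poly_Mapping.lookup m j) * c)"
  by (cases "c = 0") (auto simp: pd_poly_def)

lemma pd_poly_0 [simp]: "pd_poly j 0 = 0"
  by (simp add: pd_poly_def)

lemma single_diff_shift:
  assumes "Poly_Mapping.lookup m j > 0"
  shows "(m - Poly_Mapping.single j (1::nat)) + k = (m + k) - Poly_Mapping.single j 1"
  using assms by (intro poly_mapping_eqI) (auto simp: lookup_add lookup_minus lookup_single when_def)

lemma pd_poly_mult_single:
  "pd_poly j (Poly_Mapping.single m a * Poly_Mapping.single k b) =
   pd_poly j (Poly_Mapping.single m a) * Poly_Mapping.single k b +
   Poly_Mapping.single m a * pd_poly j (Poly_Mapping.single k b)"
proof -
  have 1: "(m - Poly_Mapping.single j 1) + k = (m + k) - Poly_Mapping.single j 1"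
    if "Poly_Mapping.lookup m j \<noteq> 0"
    using that by (intro single_diff_shift) auto
  have 2: "m + (k - Poly_Mapping.single j 1) = (m + k) - Poly_Mapping.single j 1"
    if "Poly_Mapping.lookup k j \<noteq> 0"
    using single_diff_shift[of k j m] that by (simp add: add.commute)
  show ?thesis
    using 1 2
    by (cases "Poly_Mapping.lookup m j = 0"; cases "Poly_Mapping.lookup k j = 0")
      (simp_all add: pd_poly_single mult_single lookup_add flip: single_add add: algebra_simps)
qed

lemma pd_poly_mult: "pd_poly j (p * q) = pd_poly j p * q + p * pd_poly j q"
proof (induction p rule: cpoly_induct)
  case (single m c)
  show ?case
    by (induction q rule: cpoly_induct)
      (simp_all add: pd_poly_mult_single pd_poly_add algebra_simps)
qed (simp_all add: pd_poly_add algebra_simps)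

lift_definition pd :: "nat \<Rightarrow> crat \<Rightarrow> crat" is
  "\<lambda>j (p, q). (pd_poly j p * q - p * pd_poly j q, q * q)"
proof -
  fix j and x y :: "cpoly \<times> cpoly"
  assume "fractrel x y"
  then obtain a b c d where xy: "x = (a, b)" "y = (c, d)" and nz: "b \<noteq> 0" "d \<noteq> 0"
    and eq: "a * d = c * b" by (cases x; cases y) auto
  have "pd_poly j a * d + a * pd_poly j d = pd_poly j c * b + c * pd_poly j b"
    using arg_cong[OF eq, of "pd_poly j"] by (simp add: pd_poly_mult)
  then have "(pd_poly j a * b - a * pd_poly j b) * (d * d) =
    (pd_poly j c * d - c * pd_poly j d) * (b * b)"
    using eq by algebra
  with xy nz show "fractrel (case x of (p, q) \<Rightarrow> (pd_poly j p * q - p * pd_poly j q, q * q))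
      (case y of (p, q) \<Rightarrow> (pd_poly j p * q - p * pd_poly j q, q * q))"
    by simp
qed

lemma pd_Fract:
  "q \<noteq> 0 \<Longrightarrow> pd j (Fract p q) = Fract (pd_poly j p * q - p * pd_poly j q) (q * q)"
  by transfer simp

subsection \<open>Substitution\<close>

definition subst_poly :: "(nat \<Rightarrow> cpoly) \<Rightarrow> cpoly \<Rightarrow> cpoly" where
  "subst_poly G p = (\<Sum>m\<in>Poly_Mapping.keys p.
     Poly_Mapping.single 0 (Poly_Mapping.lookup p m) *
       (\<Prod>i\<in>Poly_Mapping.keys m. G i ^ Poly_Mapping.lookup m i))"

text \<open>
  \<open>F(G\<^sub>0, G\<^sub>1, \<dots>)\<close>: any representation \<open>F = p/q\<close> whose denominator does not vanish under the
  substitution gives the same value, see \<open>subst_rat_Fract\<close>.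
\<close>

definition subst_rat :: "(nat \<Rightarrow> cpoly) \<Rightarrow> crat \<Rightarrow> crat" where
  "subst_rat G F = (THE H. \<exists>p q. F = Fract p q \<and> subst_poly G q \<noteq> 0 \<and>
     H = Fract (subst_poly G p) (subst_poly G q))"

lemma subst_poly_add: "subst_poly G (p + q) = subst_poly G p + subst_poly G q"
  unfolding subst_poly_def
  by (rule setsum_keys_plus_distrib) (auto simp: single_add distrib_right)

lemma subst_poly_0 [simp]: "subst_poly G 0 = 0"
  by (simp add: subst_poly_def)

lemma subst_poly_single:
  "subst_poly G (Poly_Mapping.single m c) =
     Poly_Mapping.single 0 c * (\<Prod>i\<in>Poly_Mapping.keys m. G i ^ Poly_Mapping.lookup m i)"
  by (cases "c = 0") (auto simp: subst_poly_def)

lemma subst_monom_superset: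
  assumes "finite A" "Poly_Mapping.keys m \<subseteq> A"
  shows "(\<Prod>i\<in>Poly_Mapping.keys m. (G i :: cpoly) ^ Poly_Mapping.lookup m i) =
    (\<Prod>i\<in>A. G i ^ Poly_Mapping.lookup m i)"
  using assms by (intro prod.mono_neutral_left) (auto simp: in_keys_iff)

lemma subst_poly_mult_single:
  "subst_poly G (Poly_Mapping.single m a * Poly_Mapping.single k b) =
   subst_poly G (Poly_Mapping.single m a) * subst_poly G (Poly_Mapping.single k b)"
proof -
  let ?A = "Poly_Mapping.keys m \<union> Poly_Mapping.keys k"
  let ?P = "\<lambda>k. \<Prod>i\<in>?A. G i ^ Poly_Mapping.lookup k i"
  have 1: "subst_poly G (Poly_Mapping.single l c) = Poly_Mapping.single 0 c * ?P l"
    if "Poly_Mapping.keys l \<subseteq> ?A" for l c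
    unfolding subst_poly_single using that by (subst subst_monom_superset[of ?A]) auto
  have 2: "?P (m + k) = ?P m * ?P k"
    by (simp add: lookup_add power_add prod.distrib)
  have 3: "(Poly_Mapping.single 0 (a * b) :: cpoly) = Poly_Mapping.single 0 a * Poly_Mapping.single 0 b"
    by (simp add: mult_single)
  show ?thesis
    unfolding mult_single[of m] 1[OF keys_add] 1[OF Un_upper1] 1[OF Un_upper2] 2 3
    by (simp only: ac_simps)
qed

lemma subst_poly_mult: "subst_poly G (p * q) = subst_poly G p * subst_poly G q"
proof (induction p rule: cpoly_induct)
  case (single m c)
  show ?case
    by (induction q rule: cpoly_induct)
      (simp_all add: subst_poly_mult_single subst_poly_add algebra_simps)
qed (simp_all add: subst_poly_add algebra_simps)

lemma subst_rat_Fract: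
  assumes "subst_poly G q \<noteq> 0"
  shows "subst_rat G (Fract p q) = Fract (subst_poly G p) (subst_poly G q)"
  unfolding subst_rat_def
proof (rule the_equality)
  fix H
  assume "\<exists>p' q'. Fract p q = Fract p' q' \<and> subst_poly G q' \<noteq> 0 \<and>
     H = Fract (subst_poly G p') (subst_poly G q')"
  then obtain p' q' where eq: "Fract p q = Fract p' q'" and nz: "subst_poly G q' \<noteq> 0"
    and H: "H = Fract (subst_poly G p') (subst_poly G q')" by blast
  have "q \<noteq> 0" "q' \<noteq> 0" using assms nz by auto
  then have "p * q' = p' * q" using eq by (simp add: eq_fract)
  then have "subst_poly G p * subst_poly G q' = subst_poly G p' * subst_poly G q"
    by (metis subst_poly_mult)
  then show "H = Fract (subst_poly G p) (subst_poly G q)"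
    using assms nz H by (simp add: eq_fract)
qed (use assms in blast)

section \<open>Rational functions and rational one-forms on projective space\<close>

definition homogeneous :: "nat \<Rightarrow> nat \<Rightarrow> cpoly set" where
  "homogeneous n d = {p. \<forall>m\<in>Poly_Mapping.keys p. Poly_Mapping.keys m \<subseteq> {..n} \<and>
     (\<Sum>i\<le>n. Poly_Mapping.lookup m i) = d}"

definition function_field :: "nat \<Rightarrow> crat set" where
  "function_field n =
     {Fract p q | p q d. p \<in> homogeneous n d \<and> q \<in> homogeneous n d \<and> q \<noteq> 0}"

text \<open>
  A one-form is written in homogeneous coordinates, \<open>\<omega> = \<Sum>\<^sub>j \<omega>\<^sub>j dX\<^sub>j\<close>, and represented by its
  coefficients.  The rational one-forms on \<open>\<P>\<^sup>n\<close> are the finite sums \<open>\<Sum>\<^sub>k a\<^sub>k db\<^sub>k\<close> with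
  \<open>a\<^sub>k\<close>, \<open>b\<^sub>k\<close> in the function field.  In characteristic zero the Kaehler differentials of
  \<open>\<complex>(\<P>\<^sup>n)\<close> embed into those of \<open>\<complex>(X\<^sub>0, \<dots>, X\<^sub>n)\<close>, hence nothing is lost.
\<close>

type_synonym form = "nat \<Rightarrow> crat"

definition diff :: "crat \<Rightarrow> form" where
  "diff F = (\<lambda>j. pd j F)"

definition rational_forms :: "nat \<Rightarrow> form set" where
  "rational_forms n = {\<lambda>j. \<Sum>k<m. a k * diff (b k) j | (m :: nat) a b.
     \<forall>k<m. a k \<in> function_field n \<and> b k \<in> function_field n}"

definition closed_form :: "form \<Rightarrow> bool" where
  "closed_form w \<longleftrightarrow> (\<forall>i j. pd i (w j) = pd j (w i))"

section \<open>Rational maps between projective spaces\<close>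

text \<open>
  The rational map \<open>[X\<^sub>0 : \<dots> : X\<^sub>n] \<mapsto> [G\<^sub>0 : \<dots> : G\<^sub>n]\<close> of \<open>\<P>\<^sup>n\<close>; base points are allowed.
  This is essential: the splitting of \<open>\<nabla>\<^sub>\<lambda>\<close> for general \<open>\<lambda>\<close> forces \<open>f(x, y, 1)\<close> to become a square,
  and no dominant map from \<open>\<P>\<^sup>n\<close> to the corresponding double cover is everywhere regular.
  Only \<open>G\<^sub>0, \<dots>, G\<^sub>n\<close> matter.
\<close>

definition rational_map :: "nat \<Rightarrow> (nat \<Rightarrow> cpoly) \<Rightarrow> bool" where
  "rational_map n G \<longleftrightarrow> (\<exists>d. \<forall>i\<le>n. G i \<in> homogeneous n d) \<and> (\<exists>i\<le>n. G i \<noteq> 0)"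

definition dominant :: "nat \<Rightarrow> (nat \<Rightarrow> cpoly) \<Rightarrow> bool" where
  "dominant n G \<longleftrightarrow> (\<forall>d. \<forall>p\<in>homogeneous n d. p \<noteq> 0 \<longrightarrow> subst_poly G p \<noteq> 0)"

definition pulled_back_field :: "nat \<Rightarrow> (nat \<Rightarrow> cpoly) \<Rightarrow> crat set" where
  "pulled_back_field n G = subst_rat G ` function_field n"

definition generically_finite :: "nat \<Rightarrow> (nat \<Rightarrow> cpoly) \<Rightarrow> bool" where
  "generically_finite n G \<longleftrightarrow> dominant n G \<and>
     (\<exists>B. finite B \<and> B \<subseteq> function_field n \<and>
       (\<forall>F\<in>function_field n. \<exists>c. (\<forall>b\<in>B. c b \<in> pulled_back_field n G) \<and> F = (\<Sum>b\<in>B. c b * b)))"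

definition deck_transformations :: "nat \<Rightarrow> (nat \<Rightarrow> cpoly) \<Rightarrow> (crat \<Rightarrow> crat) set" where
  "deck_transformations n G = {\<sigma>. bij_betw \<sigma> (function_field n) (function_field n) \<and>
     (\<forall>a\<in>function_field n. \<forall>b\<in>function_field n.
        \<sigma> (a + b) = \<sigma> a + \<sigma> b \<and> \<sigma> (a * b) = \<sigma> a * \<sigma> b) \<and>
     (\<forall>a\<in>pulled_back_field n G. \<sigma> a = a)}"

definition galois_map :: "nat \<Rightarrow> (nat \<Rightarrow> cpoly) \<Rightarrow> bool" where
  "galois_map n G \<longleftrightarrow>
     {a \<in> function_field n. \<forall>\<sigma>\<in>deck_transformations n G. \<sigma> a = a} = pulled_back_field n G"

section \<open>Meromorphic connections on the trivial bundle of rank two\<close>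

text \<open>
  The connection \<open>d + A\<close> is represented by \<open>j \<mapsto> A\<^sub>j\<close>, where \<open>A = \<Sum>\<^sub>j A\<^sub>j dX\<^sub>j\<close> is its matrix of
  one-forms.
\<close>

type_synonym connection = "nat \<Rightarrow> crat^2^2"

definition mat22 :: "'a::zero \<Rightarrow> 'a \<Rightarrow> 'a \<Rightarrow> 'a \<Rightarrow> 'a^2^2" where
  "mat22 a b c d = vector [vector [a, b], vector [c, d]]"

definition split_connection :: "form \<Rightarrow> connection" where
  "split_connection w = (\<lambda>j. mat22 (w j) 0 0 (- w j))"

text \<open>\<open>g\<^sup>*(\<Sum>\<^sub>i a\<^sub>i dX\<^sub>i) = \<Sum>\<^sub>i a\<^sub>i(G) dG\<^sub>i\<close>, applied to each entry of the connection matrix.\<close>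

definition pullback_form :: "nat \<Rightarrow> (nat \<Rightarrow> cpoly) \<Rightarrow> form \<Rightarrow> form" where
  "pullback_form n G w = (\<lambda>j. \<Sum>i\<le>n. subst_rat G (w i) * diff (Fract (G i) 1) j)"

definition pullback_connection :: "nat \<Rightarrow> (nat \<Rightarrow> cpoly) \<Rightarrow> connection \<Rightarrow> connection" where
  "pullback_connection n G A = (\<lambda>j. \<chi> r c. pullback_form n G (\<lambda>i. A i $ r $ c) j)"

text \<open>
  \<open>M\<^sup>-\<^sup>1 \<circ> (d + A) \<circ> M\<close>, the connection in the new coordinates \<open>Y'\<close> with \<open>Y = M Y'\<close>.
\<close>

definition gauge :: "crat^2^2 \<Rightarrow> connection \<Rightarrow> connection" where
  "gauge M A = (\<lambda>j. matrix_inv M ** A j ** M + matrix_inv M ** (\<chi> r c. diff (M $ r $ c) j))"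

text \<open>
  In the coordinate \<open>z = Y\<^sub>1/Y\<^sub>2\<close> of the projectivized bundle, \<open>dY + A Y = 0\<close> becomes
  \<open>dz + A\<^sub>1\<^sub>2 + (A\<^sub>1\<^sub>1 - A\<^sub>2\<^sub>2) z - A\<^sub>2\<^sub>1 z\<^sup>2 = 0\<close>.  The projective connection is this Riccati equation,
  given by its three coefficients.
\<close>

definition projective_connection :: "connection \<Rightarrow> form \<times> form \<times> form" where
  "projective_connection A =
     ((\<lambda>j. A j $ 1 $ 2), (\<lambda>j. A j $ 1 $ 1 - A j $ 2 $ 2), (\<lambda>j. - A j $ 2 $ 1))"

text \<open>
  A birational bundle transformation of the trivial projective line bundle over \<open>\<P>\<^sup>n\<close> is an element of
  \<open>PGL\<^sub>2\<close> over the function field, lifted here to an invertible matrix; another lift changes \<open>gauge\<close>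
  by a scalar one-form only.
\<close>

definition projectively_birationally_equivalent ::
    "nat \<Rightarrow> connection \<Rightarrow> connection \<Rightarrow> bool" where
  "projectively_birationally_equivalent n A B \<longleftrightarrow>
     (\<exists>M. invertible M \<and> (\<forall>r c. M $ r $ c \<in> function_field n) \<and>
       projective_connection (gauge M A) = projective_connection B)"

section \<open>The connections \<open>\<nabla>\<^sub>\<lambda>\<close>\<close>

text \<open>
  The homogeneous coordinates \<open>[x : y : z\<^sub>1 : \<dots> : z\<^bsub>n-2\<^esub> : t]\<close> are \<open>[X\<^sub>0 : \<dots> : X\<^sub>n]\<close>; below, \<open>xx\<close>, \<open>yy\<close>
  and \<open>zz\<close> are the affine coordinates \<open>x/t\<close>, \<open>y/t\<close>, \<open>z\<^sub>i/t\<close>.  Only \<open>lam 0, \<dots>, lam (n - 1)\<close> occur.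
\<close>

definition xx :: "nat \<Rightarrow> crat" where "xx n = rvar 0 / rvar n"
definition yy :: "nat \<Rightarrow> crat" where "yy n = rvar 1 / rvar n"
definition zz :: "nat \<Rightarrow> nat \<Rightarrow> crat" where "zz n i = rvar (i + 1) / rvar n"

definition quad :: "crat \<Rightarrow> crat \<Rightarrow> crat \<Rightarrow> crat" where
  "quad x y t = x^2 + y^2 + t^2 - 2 * (x * y + y * t + t * x)"

abbreviation ff :: "nat \<Rightarrow> crat" where "ff n \<equiv> quad (xx n) (yy n) 1"

definition alpha0 :: "nat \<Rightarrow> (nat \<Rightarrow> complex) \<Rightarrow> form" where
  "alpha0 n lam = (\<lambda>j.
     - (((2 * rconst (lam 0) + rconst (lam 1)) * diff (xx n) j
         - (2 * rconst (lam 1) + rconst (lam 0)) * diff (yy n) j) / 2)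
     - rconst (lam 1) * (yy n - 1) / 2 * (diff (xx n) j / xx n)
     + rconst (lam 0) * (xx n - 1) / 2 * (diff (yy n) j / yy n))"

definition alpha1 :: "nat \<Rightarrow> form" where
  "alpha1 n = (\<lambda>j. - (1 / 4) * (diff (ff n) j / ff n))"

definition alpha2 :: "nat \<Rightarrow> (nat \<Rightarrow> complex) \<Rightarrow> form" where
  "alpha2 n lam = (\<lambda>j. - alpha0 n lam j / ff n)"

definition alpha0i :: "nat \<Rightarrow> (nat \<Rightarrow> complex) \<Rightarrow> nat \<Rightarrow> form" where
  "alpha0i n lam i = (\<lambda>j. rconst (lam (i + 1)) *
     (diff (zz n i) j - zz n i * diff (ff n - (zz n i)^2) j / (2 * (ff n - (zz n i)^2))))"

definition alpha2i :: "nat \<Rightarrow> (nat \<Rightarrow> complex) \<Rightarrow> nat \<Rightarrow> form" where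
  "alpha2i n lam i = (\<lambda>j. - alpha0i n lam i j / ff n)"

definition A11 :: "nat \<Rightarrow> (nat \<Rightarrow> complex) \<Rightarrow> form" where
  "A11 n lam = (\<lambda>j. (xx n - 1) * alpha2 n lam j + alpha1 n j + 1 / 2 * (diff (yy n) j / yy n))"

definition A12 :: "nat \<Rightarrow> (nat \<Rightarrow> complex) \<Rightarrow> form" where
  "A12 n lam = (\<lambda>j. (diff (xx n) j + (xx n - 1)^2 * alpha2 n lam j
     + 2 * (xx n - 1) * alpha1 n j + alpha0 n lam j) / yy n)"

definition A21 :: "nat \<Rightarrow> (nat \<Rightarrow> complex) \<Rightarrow> form" where
  "A21 n lam = (\<lambda>j. yy n * alpha2 n lam j)"

definition A11i :: "nat \<Rightarrow> (nat \<Rightarrow> complex) \<Rightarrow> nat \<Rightarrow> form" where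
  "A11i n lam i = (\<lambda>j. (xx n - 1) * alpha2i n lam i j)"

definition A12i :: "nat \<Rightarrow> (nat \<Rightarrow> complex) \<Rightarrow> nat \<Rightarrow> form" where
  "A12i n lam i = (\<lambda>j. ((xx n - 1)^2 * alpha2i n lam i j + alpha0i n lam i j) / yy n)"

definition A21i :: "nat \<Rightarrow> (nat \<Rightarrow> complex) \<Rightarrow> nat \<Rightarrow> form" where
  "A21i n lam i = (\<lambda>j. yy n * alpha2i n lam i j)"

definition nabla :: "nat \<Rightarrow> (nat \<Rightarrow> complex) \<Rightarrow> connection" where
  "nabla n lam = (\<lambda>j.
     mat22 (A11 n lam j) (A12 n lam j) (- A21 n lam j) (- A11 n lam j)
     + (\<Sum>i = 1..n - 2.
         mat22 (A11i n lam i j) (A12i n lam i j) (- A21i n lam i j) (- A11i n lam i j)))"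

end

theory Submission
  imports Defs
begin

text \<open>
  Write \<open>f = f(x, y, 1)\<close>, \<open>\<theta> = \<alpha>\<^sub>0 + \<Sum>\<^sub>i \<alpha>\<^sub>0\<^sup>i\<close> and \<open>z = Y\<^sub>1/Y\<^sub>2\<close>.  In the coordinate \<open>u = y z + x - 1\<close> the
  Riccati equation of \<open>\<nabla>\<^sub>\<lambda>\<close> is \<open>du + \<theta> - (df/2f) u - (\<theta>/f) u\<^sup>2 = 0\<close>.  As soon as \<open>f = s\<^sup>2\<close> is a square, \<open>v = u/s\<close> satisfies
  \<open>dv + (\<theta>/s)(1 - v\<^sup>2) = 0\<close>, which has the constant solutions \<open>v = 1\<close> and \<open>v = -1\<close> and hence splits,
  with \<open>\<omega> = \<theta>/s\<close>.  The substitution \<open>x = a b\<close>, \<open>y = (1 - a)(1 - b)\<close> makes \<open>f = (a - b)\<^sup>2\<close>; it defines a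
  dominant rational map of degree two, Galois because its deck transformation swaps \<open>a\<close> and \<open>b\<close>.
  Finally \<open>\<alpha>\<^sub>0/s\<close> becomes a combination of \<open>da/a\<close>, \<open>db/b\<close>, \<open>da/(1 - a)\<close>, \<open>db/(1 - b)\<close>, and \<open>\<alpha>\<^sub>0\<^sup>i/s\<close> a
  multiple of \<open>dr/(1 - r\<^sup>2)\<close> with \<open>r = z\<^sub>i/s\<close>, so \<open>\<omega>\<close> is closed.
\<close>

section \<open>Polynomials and substitutions\<close>

text \<open>Makes numerals nonzero in \<open>crat\<close>, so that the divisions by 2 and 4 in the
  connection can be simplified.\<close>

instance fract :: ("{idom, ring_char_0}") field_char_0
proof
  show "inj (of_nat :: nat \<Rightarrow> 'a fract)"
    by (rule injI) (simp add: of_nat_fract eq_fract)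
qed

definition cconst :: "complex \<Rightarrow> cpoly" where
  "cconst c = Poly_Mapping.single 0 c"

definition cvar :: "nat \<Rightarrow> cpoly" where
  "cvar i = Poly_Mapping.single (Poly_Mapping.single i 1) 1"

lemma cconst_1 [simp]: "cconst 1 = 1"
  by (simp add: cconst_def)

lemma cconst_0 [simp]: "cconst 0 = 0"
  by (simp add: cconst_def)

lemma cvar_nonzero [simp]: "cvar i \<noteq> 0"
  by (metis cvar_def keys_zero lookup_single_eq in_keys_iff empty_iff zero_neq_one)

abbreviation ratpoly :: "cpoly \<Rightarrow> crat" where
  "ratpoly p \<equiv> Fract p 1"

lemma cvar_power: "cvar i ^ k = Poly_Mapping.single (Poly_Mapping.single i k) 1"
  by (induction k) (simp_all add: cvar_def mult_single flip: single_add single_one)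

lemma single_eq_prod:
  "(Poly_Mapping.single m c :: cpoly) =
     cconst c * (\<Prod>i\<in>Poly_Mapping.keys m. cvar i ^ Poly_Mapping.lookup m i)"
proof -
  have "(\<Prod>i\<in>A. cvar i ^ Poly_Mapping.lookup m i) =
      Poly_Mapping.single (\<Sum>i\<in>A. Poly_Mapping.single i (Poly_Mapping.lookup m i)) 1"
    if "finite A" for A
    using that by induction (simp_all add: cvar_power mult_single)
  moreover have "(\<Sum>i\<in>Poly_Mapping.keys m. Poly_Mapping.single i (Poly_Mapping.lookup m i)) = m"
    by (rule poly_mapping_eqI) (auto simp: lookup_sum lookup_single when_def in_keys_iff)
  ultimately show ?thesis
    by (simp add: cconst_def mult_single)
qed

text \<open>Constants and variables generate the polynomial ring, so facts about ring homomorphisms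
  and derivations need checking only there.\<close>

lemma cpoly_ring_induct [case_names const var add mult]:
  fixes p :: cpoly
  assumes const: "\<And>c. P (cconst c)" and var: "\<And>i. P (cvar i)"
    and add: "\<And>p q. P p \<Longrightarrow> P q \<Longrightarrow> P (p + q)"
    and mult: "\<And>p q. P p \<Longrightarrow> P q \<Longrightarrow> P (p * q)"
  shows "P p"
proof -
  have one: "P 1" using const[of 1] by simp
  have pow: "P (cvar i ^ k)" for i k
    by (induction k) (auto intro: one mult var)
  have "P (\<Prod>i\<in>A. cvar i ^ k i)" if "finite A" for A k
    using that by induction (auto intro: one mult pow)
  then have "P (Poly_Mapping.single m c)" for m c
    unfolding single_eq_prod[of m c] by (intro mult const) auto
  then show ?thesis
    using const[of 0, unfolded cconst_0] add by (induction p rule: cpoly_induct) auto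
qed

section \<open>Partial derivatives of polynomials\<close>

lemma pd_poly_cconst [simp]: "pd_poly j (cconst c) = 0"
  by (simp add: cconst_def pd_poly_single)

lemma pd_poly_1 [simp]: "pd_poly j 1 = 0"
  using pd_poly_cconst[of j 1] by simp

lemma pd_poly_cvar [simp]: "pd_poly j (cvar i) = (if i = j then 1 else 0)"
  by (simp add: cvar_def pd_poly_single lookup_single)

lemma pd_poly_uminus: "pd_poly j (- p) = - pd_poly j p"
  using pd_poly_add[of j p "- p"] by (simp add: eq_neg_iff_add_eq_0 add.commute)

lemma pd_poly_diff: "pd_poly j (p - q) = pd_poly j p - pd_poly j q"
  using pd_poly_add[of j p "- q"] by (simp add: pd_poly_uminus)

lemma pd_poly_commute: "pd_poly i (pd_poly j p) = pd_poly j (pd_poly i p)"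
  by (induction p rule: cpoly_ring_induct) (simp_all add: pd_poly_add pd_poly_mult algebra_simps)

lemma lookup_pd_poly:
  "Poly_Mapping.lookup (pd_poly j p) m =
     of_nat (Suc (Poly_Mapping.lookup m j)) * Poly_Mapping.lookup p (m + Poly_Mapping.single j 1)"
proof (induction p rule: cpoly_induct)
  case (single k c)
  show ?case
  proof (cases "k = m + Poly_Mapping.single j 1")
    case True
    then show ?thesis by (simp add: pd_poly_single lookup_single lookup_add)
  next
    case False
    \<comment> \<open>Truncated subtraction also reaches \<open>m\<close> from an exponent
      \<open>k\<close> in which \<open>j\<close> does not occur; its term then carries the factor
      0.\<close>
    have "Poly_Mapping.lookup k j = 0" if "k - Poly_Mapping.single j 1 = m"
    proof (rule ccontr)
      assume "Poly_Mapping.lookup k j \<noteq> 0"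
      then have "k = k - Poly_Mapping.single j 1 + Poly_Mapping.single j 1"
        by (intro poly_mapping_eqI) (auto simp: lookup_add lookup_minus lookup_single when_def)
      with False that show False by simp
    qed
    with False show ?thesis
      by (auto simp: pd_poly_single lookup_single when_def)
  qed
qed (simp_all add: pd_poly_add lookup_add algebra_simps)

definition mon_deg :: "(nat \<Rightarrow>\<^sub>0 nat) \<Rightarrow> nat" where
  "mon_deg m = (\<Sum>i\<in>Poly_Mapping.keys m. Poly_Mapping.lookup m i)"

lemma mon_deg_add: "mon_deg (m + k) = mon_deg m + mon_deg k"
  unfolding mon_deg_def by (rule setsum_keys_plus_distrib) auto

lemma mon_deg_single [simp]: "mon_deg (Poly_Mapping.single i k) = k"
  by (cases "k = 0") (simp_all add: mon_deg_def)

text \<open>In characteristic zero, enough partial derivatives turn a nonzero polynomial into a nonzero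
  constant.\<close>

lemma pd_closed_set_trivial:
  assumes closed: "\<And>p j. p \<in> S \<Longrightarrow> pd_poly j p \<in> S"
    and const: "\<And>c. cconst c \<in> S \<Longrightarrow> c = 0"
    and "p \<in> S"
  shows "p = 0"
proof -
  \<comment> \<open>The induction runs on a bound \<open>d\<close> for the total degree, since
    differentiation lowers it.\<close>
  have "p = 0" if "p \<in> S" "\<forall>m\<in>Poly_Mapping.keys p. mon_deg m \<le> d" for p d
    using that
  proof (induction d arbitrary: p)
    case 0
    have keys: "m = 0" if "m \<in> Poly_Mapping.keys p" for m
      using 0 that by (intro poly_mapping_eqI) (auto simp: mon_deg_def in_keys_iff)
    then have "p = cconst (Poly_Mapping.lookup p 0)"
      by (intro poly_mapping_eqI) (auto simp: cconst_def lookup_single when_def in_keys_iff)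
    with const[of "Poly_Mapping.lookup p 0"] 0 show ?case by auto
  next
    case (Suc d)
    have pd0: "pd_poly j p = 0" for j
    proof (rule Suc.IH)
      show "\<forall>m\<in>Poly_Mapping.keys (pd_poly j p). mon_deg m \<le> d"
      proof
        fix m assume "m \<in> Poly_Mapping.keys (pd_poly j p)"
        then have "m + Poly_Mapping.single j 1 \<in> Poly_Mapping.keys p"
          by (auto simp: in_keys_iff lookup_pd_poly)
        with Suc.prems(2) have "mon_deg (m + Poly_Mapping.single j 1) \<le> Suc d" by blast
        then show "mon_deg m \<le> d" by (simp add: mon_deg_add)
      qed
    qed (use closed Suc.prems in auto)
    \<comment> \<open>If \<open>j\<close> occurs in \<open>m\<close>, then
      \<open>k = m - single j 1\<close> has in the \<open>j\<close>-th derivative a positive integer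
      multiple of the coefficient of \<open>m\<close>, which is nonzero. So vanishing derivatives
      leave only the constant monomial.\<close>
    have "m = 0" if m: "m \<in> Poly_Mapping.keys p" for m
    proof (rule poly_mapping_eqI, rule ccontr)
      fix j assume j: "Poly_Mapping.lookup m j \<noteq> Poly_Mapping.lookup 0 j"
      define k where "k = m - Poly_Mapping.single j 1"
      have "m = k + Poly_Mapping.single j 1" using j unfolding k_def
        by (intro poly_mapping_eqI) (auto simp: lookup_add lookup_minus lookup_single when_def)
      with m have "Poly_Mapping.lookup (pd_poly j p) k \<noteq> 0"
        unfolding lookup_pd_poly in_keys_iff by (simp del: of_nat_Suc)
      with pd0 show False by simp
    qed
    then have "p = cconst (Poly_Mapping.lookup p 0)"
      by (intro poly_mapping_eqI) (auto simp: cconst_def lookup_single when_def in_keys_iff)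
    with const[of "Poly_Mapping.lookup p 0"] Suc show ?case by auto
  qed
  moreover have "\<forall>m\<in>Poly_Mapping.keys p. mon_deg m \<le> Max (mon_deg ` Poly_Mapping.keys p)"
    by auto
  ultimately show ?thesis using assms by blast
qed

section \<open>Substitution as a ring homomorphism, and the chain rule\<close>

lemma subst_poly_cconst [simp]: "subst_poly H (cconst c) = cconst c"
  by (simp add: cconst_def subst_poly_single)

lemma subst_poly_1 [simp]: "subst_poly H 1 = 1"
  using subst_poly_cconst[of H 1] by simp

lemma subst_poly_cvar [simp]: "subst_poly H (cvar i) = H i"
  by (simp add: cvar_def subst_poly_single)

lemma subst_poly_uminus: "subst_poly H (- p) = - subst_poly H p"
  using subst_poly_add[of H p "- p"] by (simp add: eq_neg_iff_add_eq_0 add.commute)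

lemma subst_poly_diff: "subst_poly H (p - q) = subst_poly H p - subst_poly H q"
  using subst_poly_add[of H p "- q"] by (simp add: subst_poly_uminus)

lemma subst_poly_comp:
  "subst_poly H (subst_poly G p) = subst_poly (\<lambda>i. subst_poly H (G i)) p"
  by (induction p rule: cpoly_ring_induct) (simp_all add: subst_poly_add subst_poly_mult)

lemma subst_poly_id [simp]: "subst_poly cvar p = p"
  by (induction p rule: cpoly_ring_induct) (simp_all add: subst_poly_add subst_poly_mult)

text \<open>With infinitely many variables, the sum needs a finite index set depending on
  \<open>p\<close>. Allowing every finite superset \<open>B\<close> lets the index sets of two
  polynomials be merged in the inductive steps for sums and products.\<close>

lemma chain_rule_poly:
  obtains A where "finite A"
    "\<And>B. finite B \<Longrightarrow> A \<subseteq> B \<Longrightarrow>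
       pd_poly j (subst_poly H p) = (\<Sum>i\<in>B. subst_poly H (pd_poly i p) * pd_poly j (H i))"
proof -
  define P where "P p A \<longleftrightarrow> finite A \<and> (\<forall>B. finite B \<longrightarrow> A \<subseteq> B \<longrightarrow>
    pd_poly j (subst_poly H p) = (\<Sum>i\<in>B. subst_poly H (pd_poly i p) * pd_poly j (H i)))" for p A
  have "\<exists>A. P p A"
  proof (induction p rule: cpoly_ring_induct)
    case (const c)
    have "P (cconst c) {}" by (simp add: P_def)
    then show ?case ..
  next
    case (var i)
    have "P (cvar i) {i}"
      by (auto simp: P_def if_distrib[of "subst_poly H"] if_distrib[of "\<lambda>x. x * _"] sum.delta
          cong: if_cong)
    then show ?case ..
  next
    case (add p q)
    then obtain A1 A2 where "P p A1" "P q A2" by blast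
    then have "P (p + q) (A1 \<union> A2)"
      by (auto simp: P_def pd_poly_add subst_poly_add distrib_right sum.distrib)
    then show ?case ..
  next
    case (mult p q)
    then obtain A1 A2 where "P p A1" "P q A2" by blast
    then have "P (p * q) (A1 \<union> A2)"
      by (auto simp: P_def pd_poly_add subst_poly_add pd_poly_mult subst_poly_mult
          sum.distrib sum_distrib_left sum_distrib_right algebra_simps)
    then show ?case ..
  qed
  then show ?thesis using that unfolding P_def by blast
qed

section \<open>Polynomials inside the field of rational functions\<close>

lemma Fract_conv_divide: "Fract p q = ratpoly p / ratpoly q"
  by simp

lemma ratpoly_add: "ratpoly (p + q) = ratpoly p + ratpoly q"
  by simp

lemma ratpoly_mult: "ratpoly (p * q) = ratpoly p * ratpoly q"
  by simp

lemma ratpoly_eq_0_iff [simp]: "ratpoly p = 0 \<longleftrightarrow> p = 0"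
  by (simp add: Zero_fract_def eq_fract)

lemma rconst_ratpoly: "rconst c = ratpoly (cconst c)"
  by (simp add: rconst_def cconst_def)

lemma rvar_ratpoly: "rvar i = ratpoly (cvar i)"
  by (simp add: rvar_def cvar_def)

lemma rvar_nonzero [simp]: "rvar i \<noteq> 0"
  by (simp add: rvar_ratpoly)

lemma crat_cases:
  obtains p q where "F = ratpoly p / ratpoly q" "ratpoly q \<noteq> 0"
  by (cases F) auto

section \<open>Derivations\<close>

lemma pd_ratpoly: "pd j (ratpoly p) = ratpoly (pd_poly j p)"
  by (simp add: pd_Fract)

lemma pd_add: "pd j (F + G) = pd j F + pd j G"
  by (cases F; cases G)
    (simp add: pd_Fract eq_fract pd_poly_add pd_poly_mult algebra_simps)

lemma pd_mult: "pd j (F * G) = pd j F * G + F * pd j G"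
  by (cases F; cases G)
    (simp add: pd_Fract eq_fract pd_poly_add pd_poly_mult algebra_simps)

lemma pd_1 [simp]: "pd j 1 = 0"
  using pd_mult[of j 1 1] by simp

lemma pd_0 [simp]: "pd j 0 = 0"
  using pd_mult[of j 0 0] by simp

lemma pd_uminus: "pd j (- F) = - pd j F"
  using pd_add[of j F "- F"] by (simp add: eq_neg_iff_add_eq_0 add.commute)

lemma pd_diff: "pd j (F - G) = pd j F - pd j G"
  using pd_add[of j F "- G"] by (simp add: pd_uminus)

lemma pd_divide:
  assumes "G \<noteq> 0"
  shows "pd j (F / G) = (pd j F * G - F * pd j G) / G\<^sup>2"
proof -
  have "pd j F = pd j (F / G) * G + F / G * pd j G"
    using pd_mult[of j "F / G" G] assms by simp
  with assms show ?thesis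
    by (simp add: field_simps power2_eq_square)
qed

lemma pd_power2: "pd j (F\<^sup>2) = 2 * F * pd j F"
  by (simp add: power2_eq_square pd_mult)

lemma pd_numeral [simp]: "pd j (numeral k) = 0"
proof -
  have "pd j (of_nat m) = 0" for m
    by (induction m) (simp_all add: pd_add)
  from this[of "numeral k"] show ?thesis by simp
qed

lemma pd_rconst [simp]: "pd j (rconst c) = 0"
  by (simp add: rconst_ratpoly pd_ratpoly flip: Zero_fract_def)

lemma pd_rvar: "pd j (rvar i) = (if i = j then 1 else 0)"
  by (simp add: rvar_ratpoly pd_ratpoly flip: Zero_fract_def One_fract_def)

text \<open>Two applications of the quotient rule give a numerator over the fourth power of
  \<open>Q\<close> that is symmetric in the two indices.\<close>

lemma pd_commute_divide:
  assumes P: "pd i (pd j P) = pd j (pd i P)" and Q: "pd i (pd j Q) = pd j (pd i Q)" and "Q \<noteq> 0"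
  shows "pd i (pd j (P / Q)) = pd j (pd i (P / Q))"
proof -
  have second: "pd k (pd l (P / Q)) =
      ((pd k (pd l P) * Q + pd l P * pd k Q - (pd k P * pd l Q + P * pd k (pd l Q))) * Q\<^sup>2
        - (pd l P * Q - P * pd l Q) * (2 * Q * pd k Q)) / (Q\<^sup>2)\<^sup>2" for k l
    using \<open>Q \<noteq> 0\<close> by (simp add: pd_divide pd_mult pd_diff pd_power2)
  show ?thesis
    unfolding second P Q by (rule arg_cong[where f = "\<lambda>N. N / (Q\<^sup>2)\<^sup>2"]) algebra
qed

text \<open>This is d(dF) = 0, the source of closedness for the forms below.\<close>

lemma pd_commute: "pd i (pd j F) = pd j (pd i F)"
proof -
  obtain p q where F: "F = ratpoly p / ratpoly q" and "ratpoly q \<noteq> 0"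
    by (rule crat_cases)
  then show ?thesis
    unfolding F by (intro pd_commute_divide) (simp_all add: pd_ratpoly pd_poly_commute[of i j])
qed

lemmas pd_simps = pd_add pd_mult pd_uminus pd_diff pd_divide pd_power2

section \<open>Injective substitutions\<close>

text \<open>Injectivity keeps all nonzero denominators nonzero, so \<open>subst_rat H\<close> is an
  embedding of fields. The cover and the swap of its sheets are both instances.\<close>

locale injective_subst =
  fixes H :: "nat \<Rightarrow> cpoly"
  assumes injective: "subst_poly H p = 0 \<Longrightarrow> p = 0"
begin

lemma subst_rat_ratpoly: "subst_rat H (ratpoly p) = ratpoly (subst_poly H p)"
  by (simp add: subst_rat_Fract)

lemma nonzero: "p \<noteq> 0 \<Longrightarrow> subst_poly H p \<noteq> 0"
  using injective by blast

lemma subst_rat_add: "subst_rat H (F + G) = subst_rat H F + subst_rat H G"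
  by (cases F; cases G) (simp add: subst_rat_Fract nonzero subst_poly_add subst_poly_mult)

lemma subst_rat_mult: "subst_rat H (F * G) = subst_rat H F * subst_rat H G"
  by (cases F; cases G) (simp add: subst_rat_Fract nonzero subst_poly_add subst_poly_mult)

lemma subst_rat_1: "subst_rat H 1 = 1"
  by (simp add: One_fract_def subst_rat_Fract)

lemma subst_rat_0: "subst_rat H 0 = 0"
  by (simp add: Zero_fract_def subst_rat_Fract)

lemma subst_rat_uminus: "subst_rat H (- F) = - subst_rat H F"
  using subst_rat_add[of F "- F"]
  by (simp add: eq_neg_iff_add_eq_0 add.commute subst_rat_0)

lemma subst_rat_diff: "subst_rat H (F - G) = subst_rat H F - subst_rat H G"
  using subst_rat_add[of F "- G"] by (simp add: subst_rat_uminus)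

lemma subst_rat_inverse: "subst_rat H (inverse F) = inverse (subst_rat H F)"
proof (cases "F = 0")
  case False
  then have "subst_rat H F * subst_rat H (inverse F) = 1"
    by (simp add: subst_rat_1 flip: subst_rat_mult)
  then show ?thesis by (metis inverse_unique)
qed (simp add: subst_rat_0)

lemma subst_rat_divide: "subst_rat H (F / G) = subst_rat H F / subst_rat H G"
  by (simp add: divide_inverse subst_rat_mult subst_rat_inverse)

lemma subst_rat_power: "subst_rat H (F ^ k) = subst_rat H F ^ k"
  by (induction k) (simp_all add: subst_rat_1 subst_rat_mult)

lemma subst_rat_numeral: "subst_rat H (numeral k) = numeral k"
proof -
  have "subst_rat H (of_nat m) = of_nat m" for m
    by (induction m) (simp_all add: subst_rat_0 subst_rat_1 subst_rat_add)
  from this[of "numeral k"] show ?thesis by simp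
qed

lemma subst_rat_rconst: "subst_rat H (rconst c) = rconst c"
  by (simp add: rconst_ratpoly subst_rat_ratpoly)

lemma subst_rat_rvar: "subst_rat H (rvar i) = ratpoly (H i)"
  by (simp add: rvar_ratpoly subst_rat_ratpoly)

lemma subst_rat_eq_0_iff: "subst_rat H F = 0 \<longleftrightarrow> F = 0"
proof
  assume "subst_rat H F = 0"
  then have "subst_rat H (F * inverse F) = 0" by (simp add: subst_rat_mult)
  then show "F = 0" by (metis right_inverse subst_rat_1 zero_neq_one)
qed (simp add: subst_rat_0)

lemmas subst_rat_simps = subst_rat_0 subst_rat_1 subst_rat_numeral subst_rat_rconst subst_rat_rvar
  subst_rat_add subst_rat_diff subst_rat_uminus subst_rat_mult subst_rat_divide subst_rat_power

section \<open>Pullback of one-forms and its compatibility with d\<close>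

lemma pullback_form_add:
  "pullback_form n H (\<lambda>j. u j + v j) = (\<lambda>j. pullback_form n H u j + pullback_form n H v j)"
  by (simp add: pullback_form_def subst_rat_simps distrib_right sum.distrib)

lemma pullback_form_uminus:
  "pullback_form n H (\<lambda>j. - u j) = (\<lambda>j. - pullback_form n H u j)"
  by (simp add: pullback_form_def subst_rat_simps sum_negf)

lemma pullback_form_diff:
  "pullback_form n H (\<lambda>j. u j - v j) = (\<lambda>j. pullback_form n H u j - pullback_form n H v j)"
  using pullback_form_add[of n u "\<lambda>j. - v j"] by (simp add: pullback_form_uminus)

lemma pullback_form_mult:
  "pullback_form n H (\<lambda>j. F * u j) = (\<lambda>j. subst_rat H F * pullback_form n H u j)"
  by (simp add: pullback_form_def subst_rat_simps sum_distrib_left mult.assoc)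

lemma pullback_form_divide:
  "pullback_form n H (\<lambda>j. u j / F) = (\<lambda>j. pullback_form n H u j / subst_rat H F)"
  by (simp add: pullback_form_def subst_rat_simps sum_divide_distrib)

lemma pullback_form_sum:
  "finite A \<Longrightarrow> pullback_form n H (\<lambda>j. \<Sum>i\<in>A. u i j) = (\<lambda>j. \<Sum>i\<in>A. pullback_form n H (u i) j)"
proof (induction A rule: finite_induct)
  case empty
  then show ?case by (simp add: pullback_form_def subst_rat_simps)
qed (simp add: pullback_form_add)

lemmas pullback_form_simps = pullback_form_add pullback_form_uminus pullback_form_diff
  pullback_form_mult pullback_form_divide

text \<open>The chain rule for a single function. It is stated per function because
  \<open>pullback_form\<close> sums only up to \<open>n\<close> and so may lose terms of functions
  involving later variables; the functions that satisfy it are closed under the field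
  operations.\<close>

definition pulls_back :: "nat \<Rightarrow> crat \<Rightarrow> bool" where
  "pulls_back n F \<longleftrightarrow> pullback_form n H (diff F) = diff (subst_rat H F)"

lemma pulls_backD: "pulls_back n F \<Longrightarrow> pullback_form n H (diff F) = diff (subst_rat H F)"
  by (simp add: pulls_back_def)

lemma pulls_back_rconst: "pulls_back n (rconst c)"
  by (simp add: pulls_back_def diff_def pullback_form_def subst_rat_simps)

lemma pulls_back_1: "pulls_back n 1"
  by (simp add: pulls_back_def diff_def pullback_form_def subst_rat_simps)

lemma pulls_back_numeral: "pulls_back n (numeral k)"
  by (simp add: pulls_back_def diff_def pullback_form_def subst_rat_simps)

lemma pulls_back_rvar: "i \<le> n \<Longrightarrow> pulls_back n (rvar i)"
  by (simp add: pulls_back_def diff_def pullback_form_def pd_rvar subst_rat_simps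
      if_distrib[of "subst_rat H"] if_distrib[of "\<lambda>x. x * _"] cong: if_cong)

lemma pulls_back_add: "pulls_back n F \<Longrightarrow> pulls_back n G \<Longrightarrow> pulls_back n (F + G)"
  using pullback_form_add[of n "diff F" "diff G"]
  by (simp add: pulls_back_def diff_def pd_simps subst_rat_simps)

lemma pulls_back_diff: "pulls_back n F \<Longrightarrow> pulls_back n G \<Longrightarrow> pulls_back n (F - G)"
  using pullback_form_diff[of n "diff F" "diff G"]
  by (simp add: pulls_back_def diff_def pd_simps subst_rat_simps)

lemma pulls_back_mult:
  assumes "pulls_back n F" "pulls_back n G"
  shows "pulls_back n (F * G)"
proof -
  have "diff (F * G) = (\<lambda>j. G * diff F j + F * diff G j)"
    by (simp add: diff_def pd_mult mult.commute)
  with assms show ?thesis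
    by (simp add: pulls_back_def pullback_form_simps subst_rat_mult) (simp add: diff_def pd_mult mult.commute)
qed

lemma pulls_back_divide:
  assumes "pulls_back n F" "pulls_back n G" "G \<noteq> 0"
  shows "pulls_back n (F / G)"
proof -
  have "diff (F / G) = (\<lambda>j. (G * diff F j - F * diff G j) / G\<^sup>2)"
    using assms by (simp add: diff_def pd_divide mult.commute)
  with assms show ?thesis
    by (simp add: pulls_back_def pullback_form_simps subst_rat_simps)
      (simp add: diff_def pd_divide subst_rat_eq_0_iff mult.commute)
qed

lemma pulls_back_power2: "pulls_back n F \<Longrightarrow> pulls_back n (F\<^sup>2)"
  by (simp add: power2_eq_square pulls_back_mult)

lemmas pulls_back_intros = pulls_back_rconst pulls_back_1 pulls_back_numeral pulls_back_rvar
  pulls_back_add pulls_back_diff pulls_back_mult pulls_back_divide pulls_back_power2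

end

section \<open>Homogeneous polynomials and the function field\<close>

lemma homogeneous_0 [simp]: "0 \<in> homogeneous n d"
  by (simp add: homogeneous_def)

lemma homogeneous_cconst: "cconst c \<in> homogeneous n 0"
  by (simp add: homogeneous_def cconst_def)

lemma homogeneous_1: "1 \<in> homogeneous n 0"
  using homogeneous_cconst[of 1] by simp

lemma homogeneous_cvar: "i \<le> n \<Longrightarrow> cvar i \<in> homogeneous n 1"
  by (simp add: homogeneous_def cvar_def lookup_single when_def)

lemma homogeneous_add: "p \<in> homogeneous n d \<Longrightarrow> q \<in> homogeneous n d \<Longrightarrow> p + q \<in> homogeneous n d"
  using keys_add[of p q] by (fastforce simp: homogeneous_def)

lemma homogeneous_uminus: "p \<in> homogeneous n d \<Longrightarrow> - p \<in> homogeneous n d"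
  by (simp add: homogeneous_def)

lemma homogeneous_diff: "p \<in> homogeneous n d \<Longrightarrow> q \<in> homogeneous n d \<Longrightarrow> p - q \<in> homogeneous n d"
  using homogeneous_add[of p n d "- q"] by (simp add: homogeneous_uminus)

lemma homogeneous_mult:
  assumes "p \<in> homogeneous n d" "q \<in> homogeneous n e"
  shows "p * q \<in> homogeneous n (d + e)"
  unfolding homogeneous_def
proof (rule CollectI, rule ballI)
  fix m assume "m \<in> Poly_Mapping.keys (p * q)"
  with keys_mult[of p q] obtain a b where m: "m = a + b"
    and ab: "a \<in> Poly_Mapping.keys p" "b \<in> Poly_Mapping.keys q" by blast
  have "Poly_Mapping.keys m \<subseteq> {..n}"
    using keys_add[of a b] assms ab unfolding m homogeneous_def by blast
  moreover have "(\<Sum>i\<le>n. Poly_Mapping.lookup m i) = d + e"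
    using assms ab by (simp add: m homogeneous_def lookup_add sum.distrib)
  ultimately show "Poly_Mapping.keys m \<subseteq> {..n} \<and> (\<Sum>i\<le>n. Poly_Mapping.lookup m i) = d + e" ..
qed

lemma homogeneous_power: "p \<in> homogeneous n d \<Longrightarrow> p ^ k \<in> homogeneous n (d * k)"
  by (induction k) (simp_all add: homogeneous_1 homogeneous_mult)

lemma homogeneous_sum:
  "(\<And>i. i \<in> A \<Longrightarrow> p i \<in> homogeneous n d) \<Longrightarrow> sum p A \<in> homogeneous n d"
  by (induction A rule: infinite_finite_induct) (simp_all add: homogeneous_add)

lemma homogeneous_prod:
  "(\<And>i. i \<in> A \<Longrightarrow> p i \<in> homogeneous n (d i)) \<Longrightarrow> prod p A \<in> homogeneous n (sum d A)"
  by (induction A rule: infinite_finite_induct) (simp_all add: homogeneous_1 homogeneous_mult)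

lemma keys_subset_sum:
  assumes "Poly_Mapping.keys m \<subseteq> {..n::nat}"
  shows "(\<Sum>i\<in>Poly_Mapping.keys m. Poly_Mapping.lookup m i) = (\<Sum>i\<le>n. Poly_Mapping.lookup m i)"
  using assms by (intro sum.mono_neutral_left) (auto simp: in_keys_iff)

lemma homogeneous_subst_poly:
  assumes "\<And>i. i \<le> n \<Longrightarrow> H i \<in> homogeneous n e" and p: "p \<in> homogeneous n d"
  shows "subst_poly H p \<in> homogeneous n (e * d)"
  unfolding subst_poly_def
proof (rule homogeneous_sum)
  fix m assume "m \<in> Poly_Mapping.keys p"
  then have m: "Poly_Mapping.keys m \<subseteq> {..n}" "(\<Sum>i\<le>n. Poly_Mapping.lookup m i) = d"
    using p by (auto simp: homogeneous_def)
  have "(\<Prod>i\<in>Poly_Mapping.keys m. H i ^ Poly_Mapping.lookup m i) \<in>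
    homogeneous n (\<Sum>i\<in>Poly_Mapping.keys m. e * Poly_Mapping.lookup m i)"
    using m(1) by (intro homogeneous_prod homogeneous_power assms(1)) auto
  also have "(\<Sum>i\<in>Poly_Mapping.keys m. e * Poly_Mapping.lookup m i) = e * d"
    using m keys_subset_sum[OF m(1)] by (simp flip: sum_distrib_left)
  finally show "Poly_Mapping.single 0 (Poly_Mapping.lookup p m) *
      (\<Prod>i\<in>Poly_Mapping.keys m. H i ^ Poly_Mapping.lookup m i) \<in> homogeneous n (e * d)"
    using homogeneous_mult[OF homogeneous_cconst, of _ n] by (simp add: cconst_def)
qed

lemma function_fieldI:
  "p \<in> homogeneous n d \<Longrightarrow> q \<in> homogeneous n d \<Longrightarrow> q \<noteq> 0 \<Longrightarrow> Fract p q \<in> function_field n"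
  unfolding function_field_def by blast

lemma function_fieldE:
  assumes "F \<in> function_field n"
  obtains p q d where "F = Fract p q" "p \<in> homogeneous n d" "q \<in> homogeneous n d" "q \<noteq> 0"
  using assms unfolding function_field_def by blast

lemma function_field_rconst: "rconst c \<in> function_field n"
  unfolding rconst_ratpoly by (rule function_fieldI[OF homogeneous_cconst homogeneous_1]) simp

lemma function_field_0: "0 \<in> function_field n"
  using function_field_rconst[of 0] by (simp add: rconst_ratpoly flip: Zero_fract_def)

lemma function_field_1: "1 \<in> function_field n"
  using function_field_rconst[of 1] by (simp add: rconst_ratpoly flip: One_fract_def)

lemma function_field_ratio: "i \<le> n \<Longrightarrow> k \<le> n \<Longrightarrow> rvar i / rvar k \<in> function_field n"
  by (simp add: rvar_ratpoly function_fieldI[OF homogeneous_cvar homogeneous_cvar])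

lemma function_field_add:
  assumes "F \<in> function_field n" "G \<in> function_field n"
  shows "F + G \<in> function_field n"
proof -
  from assms obtain p q d p' q' d' where
    "F = Fract p q" "p \<in> homogeneous n d" "q \<in> homogeneous n d" "q \<noteq> 0"
    "G = Fract p' q'" "p' \<in> homogeneous n d'" "q' \<in> homogeneous n d'" "q' \<noteq> 0"
    by (meson function_fieldE)
  moreover from this have "p * q' + p' * q \<in> homogeneous n (d + d')"
    by (metis homogeneous_add homogeneous_mult mult.commute)
  ultimately show ?thesis
    by (simp add: function_fieldI[OF _ homogeneous_mult])
qed

lemma function_field_mult:
  assumes "F \<in> function_field n" "G \<in> function_field n"
  shows "F * G \<in> function_field n"
proof -
  from assms obtain p q d p' q' d' where
    "F = Fract p q" "p \<in> homogeneous n d" "q \<in> homogeneous n d" "q \<noteq> 0"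
    "G = Fract p' q'" "p' \<in> homogeneous n d'" "q' \<in> homogeneous n d'" "q' \<noteq> 0"
    by (meson function_fieldE)
  then show ?thesis
    by (simp add: function_fieldI[OF homogeneous_mult homogeneous_mult])
qed

lemma function_field_uminus: "F \<in> function_field n \<Longrightarrow> - F \<in> function_field n"
  by (erule function_fieldE) (simp add: function_fieldI[OF homogeneous_uminus])

lemma function_field_diff: "F \<in> function_field n \<Longrightarrow> G \<in> function_field n \<Longrightarrow> F - G \<in> function_field n"
  using function_field_add[of F n "- G"] by (simp add: function_field_uminus)

lemma function_field_inverse: "F \<in> function_field n \<Longrightarrow> inverse F \<in> function_field n"
proof (cases "F = 0")
  case False
  assume "F \<in> function_field n"
  then obtain p q d where "F = Fract p q" "p \<in> homogeneous n d" "q \<in> homogeneous n d" "q \<noteq> 0"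
    by (rule function_fieldE)
  moreover from this False have "p \<noteq> 0" by (auto simp: Zero_fract_def eq_fract)
  ultimately show ?thesis by (simp add: function_fieldI)
qed (simp add: function_field_0)

lemma function_field_divide: "F \<in> function_field n \<Longrightarrow> G \<in> function_field n \<Longrightarrow> F / G \<in> function_field n"
  by (simp add: divide_inverse function_field_mult function_field_inverse)

lemma function_field_numeral: "numeral k \<in> function_field n"
proof -
  have "of_nat m \<in> function_field n" for m
    by (induction m) (simp_all add: function_field_0 function_field_1 function_field_add)
  from this[of "numeral k"] show ?thesis by simp
qed

lemmas function_field_intros = function_field_0 function_field_1 function_field_numeral
  function_field_rconst function_field_ratio function_field_add function_field_diff
  function_field_uminus function_field_mult function_field_divide

lemma (in injective_subst) subst_rat_function_field:
  assumes "\<And>i. i \<le> n \<Longrightarrow> H i \<in> homogeneous n e" "F \<in> function_field n"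
  shows "subst_rat H F \<in> function_field n"
  using assms(2)
  by (rule function_fieldE)
    (simp add: subst_rat_Fract nonzero
      function_fieldI[OF homogeneous_subst_poly[OF assms(1)] homogeneous_subst_poly[OF assms(1)]])

text \<open>A homogeneous polynomial of degree \<open>d\<close> divided by \<open>X\<^sub>n\<^sup>d\<close> is a polynomial in the affine
  coordinates, hence the function field is generated by the latter.\<close>

lemma function_field_generated:
  assumes "F \<in> function_field n"
    and const: "\<And>c. rconst c \<in> L" and ratio: "\<And>i. i \<le> n \<Longrightarrow> rvar i / rvar n \<in> L"
    and add: "\<And>a b. a \<in> L \<Longrightarrow> b \<in> L \<Longrightarrow> a + b \<in> L"
    and mult: "\<And>a b. a \<in> L \<Longrightarrow> b \<in> L \<Longrightarrow> a * b \<in> L"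
    and inverse: "\<And>a. a \<in> L \<Longrightarrow> inverse a \<in> L"
  shows "F \<in> L"
proof -
  have zero: "0 \<in> L" using const[of 0] by (simp add: rconst_ratpoly flip: Zero_fract_def)
  have one: "1 \<in> L" using const[of 1] by (simp add: rconst_ratpoly flip: One_fract_def)
  have pow: "a ^ k \<in> L" if "a \<in> L" for a k
    by (induction k) (auto intro: one mult that)
  have prod: "prod a A \<in> L" if "\<And>i. i \<in> A \<Longrightarrow> a i \<in> L" for a and A :: "nat set"
    using that by (induction A rule: infinite_finite_induct) (auto intro: one mult)
  have sum: "sum a A \<in> L" if "\<And>i. i \<in> A \<Longrightarrow> a i \<in> L" for a and A :: "(nat \<Rightarrow>\<^sub>0 nat) set"
    using that by (induction A rule: infinite_finite_induct) (auto intro: zero add)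
  have ratpoly_sum: "ratpoly (sum a A) = (\<Sum>i\<in>A. ratpoly (a i))" for a and A :: "(nat \<Rightarrow>\<^sub>0 nat) set"
    by (induction A rule: infinite_finite_induct) (simp_all only: sum.infinite sum.empty
      sum.insert ratpoly_add Zero_fract_def not_False_eq_True)
  have ratpoly_power: "ratpoly (p ^ k) = ratpoly p ^ k" for p k
    by (induction k) (simp_all only: power_0 power_Suc ratpoly_mult One_fract_def)
  have ratpoly_prod: "ratpoly (prod a A) = (\<Prod>i\<in>A. ratpoly (a i))" for a and A :: "nat set"
    by (induction A rule: infinite_finite_induct) (simp_all only: prod.infinite prod.empty
      prod.insert ratpoly_mult One_fract_def not_False_eq_True)
  have hom: "ratpoly p / rvar n ^ d \<in> L" if p: "p \<in> homogeneous n d" for p d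
  proof -
    have "ratpoly p / rvar n ^ d =
      (\<Sum>m\<in>Poly_Mapping.keys p. ratpoly (Poly_Mapping.single m (Poly_Mapping.lookup p m)) / rvar n ^ d)"
    proof -
      have "p = (\<Sum>m\<in>Poly_Mapping.keys p. Poly_Mapping.single m (Poly_Mapping.lookup p m))"
        by (rule poly_mapping_eqI) (auto simp: lookup_sum lookup_single when_def in_keys_iff)
      then have "ratpoly p = ratpoly (\<Sum>m\<in>Poly_Mapping.keys p.
          Poly_Mapping.single m (Poly_Mapping.lookup p m))" by (rule arg_cong)
      then show ?thesis by (simp only: ratpoly_sum sum_divide_distrib)
    qed
    also have "\<dots> \<in> L"
    proof (rule sum)
      fix m assume "m \<in> Poly_Mapping.keys p"
      then have m: "Poly_Mapping.keys m \<subseteq> {..n}" "(\<Sum>i\<le>n. Poly_Mapping.lookup m i) = d"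
        using p by (auto simp: homogeneous_def)
      \<comment> \<open>The exponents of \<open>m\<close> add up to \<open>d\<close>, so each power
        of a variable gets an equal power of X_n as denominator.\<close>
      then have "rvar n ^ d = (\<Prod>i\<in>Poly_Mapping.keys m. rvar n ^ Poly_Mapping.lookup m i)"
        by (simp add: keys_subset_sum power_sum[symmetric])
      then have "ratpoly (Poly_Mapping.single m c) / rvar n ^ d =
          rconst c * (\<Prod>i\<in>Poly_Mapping.keys m. (rvar i / rvar n) ^ Poly_Mapping.lookup m i)" for c
        unfolding single_eq_prod[of m c] ratpoly_mult ratpoly_prod ratpoly_power
        by (simp add: power_divide prod_dividef flip: rconst_ratpoly rvar_ratpoly)
      then show "ratpoly (Poly_Mapping.single m (Poly_Mapping.lookup p m)) / rvar n ^ d \<in> L"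
        using m(1) by (auto intro!: mult const prod pow ratio)
    qed
    finally show ?thesis .
  qed
  from assms(1) obtain p q d where F: "F = Fract p q"
    and "p \<in> homogeneous n d" "q \<in> homogeneous n d" by (rule function_fieldE)
  \<comment> \<open>Numerator and denominator have the same degree, so dividing both by the same
    power of X_n does not change the quotient.\<close>
  then have "(ratpoly p / rvar n ^ d) * inverse (ratpoly q / rvar n ^ d) \<in> L"
    by (intro mult inverse hom)
  also have "(ratpoly p / rvar n ^ d) * inverse (ratpoly q / rvar n ^ d) = F"
  proof -
    have "P / v * inverse (Q / v) = P / Q" if "v \<noteq> 0" for P Q v :: crat
      using that by simp
    from this[of "rvar n ^ d"] show ?thesis
      unfolding F Fract_conv_divide[of p q] by (simp only: power_not_zero rvar_nonzero not_False_eq_True)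
  qed
  finally show ?thesis .
qed

section \<open>The double cover\<close>

lemma cconst_eq_0_iff [simp]: "cconst c = 0 \<longleftrightarrow> c = 0"
  by (metis cconst_0 cconst_def lookup_single_eq lookup_zero)

lemma cvar_inject [simp]: "cvar i = cvar j \<longleftrightarrow> i = j"
proof
  assume "cvar i = cvar j"
  then have "pd_poly i (cvar i) = pd_poly i (cvar j)" by simp
  then show "i = j" by (simp split: if_splits)
qed simp

text \<open>
  In the affine coordinates \<open>a = X\<^sub>0/X\<^sub>n\<close>, \<open>b = X\<^sub>1/X\<^sub>n\<close> this is \<open>x = a b\<close>, \<open>y = (1 - a)(1 - b)\<close>, with the
  \<open>z\<^sub>i\<close> unchanged; then \<open>f(x, y, 1) = (a - b)\<^sup>2\<close>.  The values at indices beyond \<open>n\<close> are irrelevant for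
  the map and chosen to make the substitution injective on all polynomials.
\<close>

definition cover_map :: "nat \<Rightarrow> nat \<Rightarrow> cpoly" where
  "cover_map n i =
     (if i = 0 then cvar 0 * cvar 1
      else if i = 1 then (cvar n - cvar 0) * (cvar n - cvar 1)
      else if i \<le> n then cvar i * cvar n
      else cvar i)"

text \<open>For \<open>n \<ge> 2\<close> the variable X_n is fixed, so this exchanges the affine
  coordinates a and b.\<close>

definition swap_map :: "nat \<Rightarrow> cpoly" where
  "swap_map i = cvar (if i = 0 then 1 else if i = 1 then 0 else i)"

lemma sum_eq_single:
  assumes "finite B" "l \<in> B" "\<And>i. i \<in> B \<Longrightarrow> i \<noteq> l \<Longrightarrow> g i = 0"
  shows "sum g B = g l"
proof -
  have "sum g B = sum g {l}" using assms by (intro sum.mono_neutral_right) auto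
  then show ?thesis by simp
qed

text \<open>By the chain rule, a relation \<open>p(G\<^sub>0, G\<^sub>1, \<dots>) = 0\<close> gives a linear system for the \<open>(\<partial>\<^sub>i p)(G)\<close>, whose
  matrix, the Jacobian of \<open>G\<close>, is nonsingular.\<close>

lemma injective_subst_cover_map:
  assumes n: "n \<ge> 2"
  shows "injective_subst (cover_map n)"
proof
  fix p assume "subst_poly (cover_map n) p = 0"
  \<comment> \<open>The kernel is closed under partial derivatives and contains no nonzero constant,
    so \<open>pd_closed_set_trivial\<close> will make it zero.\<close>
  have "subst_poly (cover_map n) (pd_poly j p) = 0" if p: "subst_poly (cover_map n) p = 0" for p j
  proof -
    define c where "c i = subst_poly (cover_map n) (pd_poly i p)" for i
    have system: "\<exists>B. finite B \<and> {..n} \<subseteq> B \<and> j \<in> B \<and>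
        (\<Sum>i\<in>B. c i * pd_poly l (cover_map n i)) = 0" for l
    proof -
      obtain A where A: "finite A" "\<And>B. finite B \<Longrightarrow> A \<subseteq> B \<Longrightarrow>
        pd_poly l (subst_poly (cover_map n) p) = (\<Sum>i\<in>B. c i * pd_poly l (cover_map n i))"
        unfolding c_def by (rule chain_rule_poly[of l "cover_map n" p]) blast
      show ?thesis
        using A(1) A(2)[of "A \<union> {..n} \<union> {j}"] p by (intro exI[of _ "A \<union> {..n} \<union> {j}"]) auto
    qed
    \<comment> \<open>For \<open>n \<ge> 2\<close>, only the components 0 and 1 involve X_0 or X_1,
      so two equations in two unknowns split off.\<close>
    have two: "c 0 * pd_poly l (cover_map n 0) + c 1 * pd_poly l (cover_map n 1) = 0"
      if l: "l \<in> {0, 1}" for l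
    proof -
      obtain B where B: "finite B" "{..n} \<subseteq> B" "(\<Sum>i\<in>B. c i * pd_poly l (cover_map n i)) = 0"
        using system by blast
      have "(\<Sum>i\<in>B. c i * pd_poly l (cover_map n i)) = (\<Sum>i\<in>{0, 1}. c i * pd_poly l (cover_map n i))"
        using B(1,2) n l by (intro sum.mono_neutral_right) (auto simp: cover_map_def pd_poly_mult)
      with B(3) show ?thesis by simp
    qed
    have "c 0 * cvar 1 + c 1 * (cvar 1 - cvar n) = 0" "c 0 * cvar 0 + c 1 * (cvar 0 - cvar n) = 0"
      using two[of 0] two[of 1] n by (simp_all add: cover_map_def pd_poly_mult pd_poly_diff)
    \<comment> \<open>Eliminating \<open>c 0\<close>; the factor X_n (X_0 - X_1) is, up to sign, the
      determinant of this block.\<close>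
    then have "c 1 * (cvar n * (cvar 0 - cvar 1)) = 0" by algebra
    then have c1: "c 1 = 0" by simp
    with \<open>c 0 * cvar 1 + c 1 * (cvar 1 - cvar n) = 0\<close> have c0: "c 0 = 0" by simp
    have single: "c l * pd_poly l (cover_map n l) = 0"
      if "\<And>i. i \<noteq> l \<Longrightarrow> c i * pd_poly l (cover_map n i) = 0" "l \<le> n \<or> l = j" for l
    proof -
      obtain B where "finite B" "{..n} \<subseteq> B" "j \<in> B" "(\<Sum>i\<in>B. c i * pd_poly l (cover_map n i)) = 0"
        using system by blast
      with that show ?thesis using sum_eq_single[of B l "\<lambda>i. c i * pd_poly l (cover_map n i)"] by auto
    qed
    \<comment> \<open>Such an X_l occurs in component \<open>l\<close> alone.\<close>
    have mid: "c l = 0" if "2 \<le> l" "l < n" for l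
      using single[of l] that n c0 c1 by (auto simp: cover_map_def pd_poly_mult split: if_splits)
    \<comment> \<open>X_n occurs in all components from 1 to \<open>n\<close>, so its equation is
      used only once the other unknowns in it vanish. It leaves \<open>c n\<close> times 2 X_n, the
      derivative of the square of X_n.\<close>
    have "c i * pd_poly n (cover_map n i) = 0" if i: "i \<noteq> n" for i
    proof -
      consider "i = 0" | "i = 1" | "2 \<le> i" "i < n" | "i > n" using i n by linarith
      then show ?thesis by cases (use c0 c1 mid in \<open>auto simp: cover_map_def\<close>)
    qed
    then have "c n * (cvar n + cvar n) = 0"
      using single[of n] n by (simp add: cover_map_def pd_poly_mult)
    then have cn: "c n = 0" by (simp flip: mult_2)
    have "c j = 0"
    proof (cases "j \<le> n")
      case True
      then consider "j = 0" | "j = 1" | "2 \<le> j" "j < n" | "j = n" using n by linarith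
      then show ?thesis by cases (use c0 c1 mid cn in auto)
    next
      case False
      then show ?thesis
        using single[of j] n c0 c1 by (auto simp: cover_map_def pd_poly_mult)
    qed
    then show ?thesis by (simp add: c_def)
  qed
  then show "p = 0"
    using \<open>subst_poly (cover_map n) p = 0\<close>
    by (intro pd_closed_set_trivial[of "{p. subst_poly (cover_map n) p = 0}" p])
      auto
qed

lemma subst_poly_swap_swap: "subst_poly swap_map (subst_poly swap_map p) = p"
proof -
  have "(\<lambda>i. subst_poly swap_map (swap_map i)) = cvar"
    by (auto simp: swap_map_def)
  then show ?thesis by (simp add: subst_poly_comp)
qed

text \<open>An involution is injective.\<close>

interpretation swap: injective_subst swap_map
  by unfold_locales (metis subst_poly_swap_swap subst_poly_0)

lemma subst_rat_swap_swap: "subst_rat swap_map (subst_rat swap_map F) = F"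
  by (cases F) (simp add: subst_rat_Fract swap.nonzero subst_poly_swap_swap)

text \<open>Every component of the cover is symmetric in X_0 and X_1.\<close>

lemma subst_poly_swap_cover:
  assumes "n \<ge> 2"
  shows "subst_poly swap_map (subst_poly (cover_map n) p) = subst_poly (cover_map n) p"
proof -
  have "(\<lambda>i. subst_poly swap_map (cover_map n i)) = cover_map n"
    using assms by (auto simp: cover_map_def subst_poly_mult subst_poly_diff swap_map_def mult.commute)
  then show ?thesis by (simp add: subst_poly_comp)
qed

lemma swap_map_homogeneous: "n \<ge> 2 \<Longrightarrow> i \<le> n \<Longrightarrow> swap_map i \<in> homogeneous n 1"
  by (simp add: swap_map_def homogeneous_cvar[simplified])

lemma cover_map_homogeneous:
  assumes "n \<ge> 2" "i \<le> n"
  shows "cover_map n i \<in> homogeneous n 2"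
proof -
  have "p * q \<in> homogeneous n 2" if "p \<in> homogeneous n 1" "q \<in> homogeneous n 1" for p q
    using homogeneous_mult[OF that] by (simp add: numeral_2_eq_2)
  with assms show ?thesis
    by (simp add: cover_map_def homogeneous_diff homogeneous_cvar[simplified])
qed

section \<open>The pulled-back functions form a field\<close>

lemma (in injective_subst) pulled_back_field_add:
  "F \<in> pulled_back_field n H \<Longrightarrow> G \<in> pulled_back_field n H \<Longrightarrow> F + G \<in> pulled_back_field n H"
  unfolding pulled_back_field_def by (auto simp: function_field_add simp flip: subst_rat_add)

lemma (in injective_subst) pulled_back_field_mult:
  "F \<in> pulled_back_field n H \<Longrightarrow> G \<in> pulled_back_field n H \<Longrightarrow> F * G \<in> pulled_back_field n H"
  unfolding pulled_back_field_def by (auto simp: function_field_mult simp flip: subst_rat_mult)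

lemma (in injective_subst) pulled_back_field_uminus:
  "F \<in> pulled_back_field n H \<Longrightarrow> - F \<in> pulled_back_field n H"
  unfolding pulled_back_field_def by (auto simp: function_field_uminus simp flip: subst_rat_uminus)

lemma (in injective_subst) pulled_back_field_diff:
  "F \<in> pulled_back_field n H \<Longrightarrow> G \<in> pulled_back_field n H \<Longrightarrow> F - G \<in> pulled_back_field n H"
  unfolding pulled_back_field_def by (auto simp: function_field_diff simp flip: subst_rat_diff)

lemma (in injective_subst) pulled_back_field_inverse:
  "F \<in> pulled_back_field n H \<Longrightarrow> inverse F \<in> pulled_back_field n H"
  unfolding pulled_back_field_def by (auto simp: function_field_inverse simp flip: subst_rat_inverse)

lemma (in injective_subst) pulled_back_field_rconst: "rconst c \<in> pulled_back_field n H"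
  unfolding pulled_back_field_def using function_field_rconst subst_rat_rconst by (metis imageI)

lemma (in injective_subst) pulled_back_field_numeral: "numeral k \<in> pulled_back_field n H"
  unfolding pulled_back_field_def using function_field_numeral subst_rat_numeral by (metis imageI)

lemma (in injective_subst) pulled_back_field_1: "1 \<in> pulled_back_field n H"
  unfolding pulled_back_field_def using function_field_1 subst_rat_1 by (metis imageI)

lemma (in injective_subst) pulled_back_field_0: "0 \<in> pulled_back_field n H"
  unfolding pulled_back_field_def using function_field_0 subst_rat_0 by (metis imageI)

lemmas (in injective_subst) pulled_back_field_intros = pulled_back_field_0 pulled_back_field_1
  pulled_back_field_numeral pulled_back_field_rconst pulled_back_field_add pulled_back_field_diff
  pulled_back_field_uminus pulled_back_field_mult pulled_back_field_inverse

section \<open>The quadratic field extension defined by the cover\<close>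

locale double_cover =
  fixes n :: nat
  assumes n: "n \<ge> 2"
begin

sublocale injective_subst "cover_map n"
  by (rule injective_subst_cover_map[OF n])

abbreviation K :: "crat set" where
  "K \<equiv> pulled_back_field n (cover_map n)"

definition a :: crat where "a = rvar 0 / rvar n"
definition b :: crat where "b = rvar 1 / rvar n"
text \<open>A square root of the pullback of f. It generates the function field over
  \<open>K\<close>, and the swap negates it.\<close>

definition s :: crat where "s = a - b"

lemma subst_rat_xx: "subst_rat (cover_map n) (xx n) = a * b"
proof -
  have "ratpoly (cover_map n 0) / ratpoly (cover_map n n) =
    (rvar 0 * rvar 1) / (rvar n * rvar n)"
    using n by (simp only: cover_map_def rvar_ratpoly ratpoly_mult) simp
  then show ?thesis
    by (simp add: xx_def a_def b_def subst_rat_simps del: divide_fract)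
qed

lemma subst_rat_yy: "subst_rat (cover_map n) (yy n) = (1 - a) * (1 - b)"
proof -
  have "ratpoly (cover_map n 1) / ratpoly (cover_map n n) =
    ((rvar n - rvar 0) * (rvar n - rvar 1)) / (rvar n * rvar n)"
    using n by (simp only: cover_map_def rvar_ratpoly ratpoly_mult) simp
  also have "\<dots> = (1 - a) * (1 - b)"
    by (simp add: a_def b_def field_simps)
  finally show ?thesis
    by (simp only: yy_def subst_rat_simps)
qed

lemma subst_rat_ratio:
  assumes "2 \<le> i" "i \<le> n"
  shows "subst_rat (cover_map n) (rvar i / rvar n) = rvar i / rvar n"
proof -
  have "ratpoly (cover_map n i) / ratpoly (cover_map n n) = (rvar i * rvar n) / (rvar n * rvar n)"
    using n assms by (simp only: cover_map_def rvar_ratpoly ratpoly_mult) simp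
  then show ?thesis
    by (simp add: subst_rat_simps del: divide_fract)
qed

lemma subst_rat_zz: "1 \<le> i \<Longrightarrow> i \<le> n - 2 \<Longrightarrow> subst_rat (cover_map n) (zz n i) = zz n i"
  using n by (simp add: zz_def subst_rat_ratio)

lemma pd_0_s: "pd 0 s = 1 / rvar n"
  using n by (simp add: s_def a_def b_def pd_simps pd_rvar power2_eq_square)

text \<open>Constants have derivative 0, unlike \<open>s\<close>. That \<open>s\<close> differs from
  1 makes \<open>{1, s}\<close> a set of two elements, as the spanning sum in
  \<open>generically_finite_cover\<close> requires.\<close>

lemma s_nonconst: "s \<noteq> 0" "s \<noteq> 1"
  using pd_0_s by auto

lemma subst_rat_ff: "subst_rat (cover_map n) (ff n) = s\<^sup>2"
  by (simp only: quad_def subst_rat_simps subst_rat_xx subst_rat_yy s_def)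
    (simp add: power2_eq_square algebra_simps)

text \<open>With x = ab and y = (1 - a)(1 - b) one has a + b = 1 + x - y, and the square of
  \<open>s\<close> is the discriminant (a + b)^2 - 4ab. So a and b are the roots of a quadratic over
  \<open>K\<close>.\<close>

lemma sum_prod_in_K: "a * b \<in> K" "a + b \<in> K" "s\<^sup>2 \<in> K"
proof -
  have xy: "xx n \<in> function_field n" "yy n \<in> function_field n"
    using n by (simp_all add: xx_def yy_def function_field_ratio)
  then show ab: "a * b \<in> K"
    unfolding pulled_back_field_def by (metis imageI subst_rat_xx)
  have "(1 - a) * (1 - b) \<in> K"
    unfolding pulled_back_field_def using xy by (metis imageI subst_rat_yy)
  with ab have "1 + a * b - (1 - a) * (1 - b) \<in> K"
    by (intro pulled_back_field_diff pulled_back_field_add pulled_back_field_1)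
  then show "a + b \<in> K" by (simp add: algebra_simps)
  with ab have "(a + b) * (a + b) - 4 * (a * b) \<in> K"
    using pulled_back_field_mult[of "a + b" n "a + b"] pulled_back_field_mult[of 4 n "a * b"]
    by (intro pulled_back_field_diff) (simp_all add: pulled_back_field_numeral)
  then show "s\<^sup>2 \<in> K" by (simp add: s_def power2_eq_square algebra_simps)
qed

text \<open>The set K + K s is a field, since the square of \<open>s\<close> is in \<open>K\<close>,
  and it contains the generators of the function field. Hence the degree is at most two.\<close>

lemma function_field_decompose:
  assumes "F \<in> function_field n"
  obtains c d where "c \<in> K" "d \<in> K" "F = c + d * s"
proof -
  define L where "L = {c + d * s | c d. c \<in> K \<and> d \<in> K}"
  have LI: "c + d * s \<in> L" if "c \<in> K" "d \<in> K" for c d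
    using that unfolding L_def by blast
  have KL: "c \<in> L" if "c \<in> K" for c
    using LI[OF that pulled_back_field_0] by simp
  have "F \<in> L"
  proof (rule function_field_generated[OF assms])
    show "rconst c \<in> L" for c
      by (rule KL[OF pulled_back_field_rconst])
    show "rvar i / rvar n \<in> L" if "i \<le> n" for i
    proof -
      \<comment> \<open>The coefficients in a = (a + b)/2 + s/2 and b = (a + b)/2 - s/2.\<close>
      have half: "(a + b) * inverse 2 \<in> K" "inverse 2 \<in> K" "- inverse 2 \<in> K"
        by (intro pulled_back_field_intros sum_prod_in_K)+
      consider "i = 0" | "i = 1" | "2 \<le> i" by linarith
      then show ?thesis
      proof cases
        case 1
        have "a = (a + b) * inverse 2 + inverse 2 * s" by (simp add: s_def field_simps)
        with LI half 1 show ?thesis by (metis a_def)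
      next
        case 2
        have "b = (a + b) * inverse 2 + - inverse 2 * s" by (simp add: s_def field_simps)
        with LI half 2 show ?thesis by (metis b_def)
      next
        case 3
        then show ?thesis
          using subst_rat_ratio[of i] that function_field_ratio[of i n n]
          by (intro KL) (force simp: pulled_back_field_def intro!: image_eqI)
      qed
    qed
    show "u + v \<in> L" if uv: "u \<in> L" "v \<in> L" for u v
    proof -
      from uv obtain c d c' d' where cd: "c \<in> K" "d \<in> K" "c' \<in> K" "d' \<in> K"
        and "u = c + d * s" "v = c' + d' * s" unfolding L_def by blast
      then have "u + v = (c + c') + (d + d') * s" by algebra
      also have "\<dots> \<in> L" using cd by (intro LI pulled_back_field_intros)
      finally show ?thesis .
    qed
    show "u * v \<in> L" if uv: "u \<in> L" "v \<in> L" for u v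
    proof -
      from uv obtain c d c' d' where cd: "c \<in> K" "d \<in> K" "c' \<in> K" "d' \<in> K"
        and "u = c + d * s" "v = c' + d' * s" unfolding L_def by blast
      then have "u * v = (c * c' + d * d' * s\<^sup>2) + (c * d' + c' * d) * s" by algebra
      also have "\<dots> \<in> L" using cd sum_prod_in_K(3) by (intro LI pulled_back_field_intros)
      finally show ?thesis .
    qed
    show "inverse u \<in> L" if "u \<in> L" for u
    proof -
      from that obtain c d where cd: "c \<in> K" "d \<in> K" and u: "u = c + d * s"
        unfolding L_def by blast
      show ?thesis
      \<comment> \<open>The inverse of \<open>u\<close> is its conjugate \<open>c - d * s\<close>
        over the norm \<open>N\<close>. When the conjugate vanishes the norm does too, but then
        \<open>u = 2c\<close> already lies in \<open>K\<close>.\<close>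
      proof (cases "c - d * s = 0")
        case True
        then have "u = c + c" using u by simp
        moreover have "inverse (c + c) \<in> L"
          using cd by (intro KL pulled_back_field_intros)
        ultimately show ?thesis by simp
      next
        case False
        define N where "N = c * c - d * d * s\<^sup>2"
        have N: "N = (c - d * s) * u" unfolding N_def u by algebra
        have "N \<in> K" unfolding N_def using cd sum_prod_in_K(3) by (intro pulled_back_field_intros)
        then have "c * inverse N + - (d * inverse N) * s \<in> L"
          using cd by (intro LI pulled_back_field_intros)
        also have "c * inverse N + - (d * inverse N) * s = (c - d * s) * inverse N"
          by algebra
        also have "\<dots> = inverse u" using False by (simp add: N)
        finally show ?thesis .
      qed
    qed
  qed
  then show ?thesis using that unfolding L_def by blast
qed

lemma rational_map_cover: "rational_map n (cover_map n)"
  unfolding rational_map_def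
proof
  show "\<exists>d. \<forall>i\<le>n. cover_map n i \<in> homogeneous n d"
    using cover_map_homogeneous[OF n] by blast
  show "\<exists>i\<le>n. cover_map n i \<noteq> 0"
    by (intro exI[of _ 0]) (simp add: cover_map_def)
qed

lemma generically_finite_cover: "generically_finite n (cover_map n)"
  unfolding generically_finite_def
proof (intro conjI exI[of _ "{1, s}"] ballI)
  show "dominant n (cover_map n)"
    by (simp add: dominant_def nonzero)
  show "{1, s} \<subseteq> function_field n"
    using n by (auto simp: s_def a_def b_def function_field_intros)
  fix F assume "F \<in> function_field n"
  then obtain c d where "c \<in> K" "d \<in> K" "F = c + d * s"
    by (rule function_field_decompose)
  with s_nonconst show "\<exists>c. (\<forall>b\<in>{1, s}. c b \<in> K) \<and> F = (\<Sum>b\<in>{1, s}. c b * b)"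
    by (intro exI[of _ "\<lambda>x. if x = 1 then c else d"]) auto
qed simp

lemma swap_fixes_K: "F \<in> K \<Longrightarrow> subst_rat swap_map F = F"
  unfolding pulled_back_field_def
proof (erule imageE)
  fix G assume "F = subst_rat (cover_map n) G"
  then show ?thesis
    by (cases G) (simp add: subst_rat_Fract nonzero swap.nonzero subst_poly_swap_cover n)
qed

lemma swap_deck: "subst_rat swap_map \<in> deck_transformations n (cover_map n)"
  unfolding deck_transformations_def
proof (intro CollectI conjI ballI)
  have *: "subst_rat swap_map F \<in> function_field n" if "F \<in> function_field n" for F
    using swap_map_homogeneous[OF n] that by (rule swap.subst_rat_function_field)
  show "bij_betw (subst_rat swap_map) (function_field n) (function_field n)"
    by (rule bij_betw_byWitness[where f' = "subst_rat swap_map"])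
      (auto simp: subst_rat_swap_swap *)
qed (simp_all add: swap.subst_rat_add swap.subst_rat_mult swap_fixes_K)

lemma swap_s: "subst_rat swap_map s = - s"
  using n by (simp add: s_def a_def b_def swap.subst_rat_simps swap_map_def flip: rvar_ratpoly)

text \<open>Invariance under the swap gives c + d s = c - d s, hence d = 0 and the function is in
  \<open>K\<close>. Conversely, deck transformations fix \<open>K\<close> by definition.\<close>

lemma galois_map_cover: "galois_map n (cover_map n)"
  unfolding galois_map_def
proof (intro equalityI subsetI CollectI conjI ballI)
  fix F assume "F \<in> {F \<in> function_field n. \<forall>\<sigma>\<in>deck_transformations n (cover_map n). \<sigma> F = F}"
  then have F: "F \<in> function_field n" "subst_rat swap_map F = F"
    using swap_deck by auto
  from F(1) obtain c d where cd: "c \<in> K" "d \<in> K" "F = c + d * s"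
    by (rule function_field_decompose)
  then have "subst_rat swap_map F = c - d * s"
    by (simp add: swap.subst_rat_add swap.subst_rat_mult swap_s swap_fixes_K)
  with F(2) cd have "c - d * s = c + d * s" by simp
  then have "2 * (d * s) = 0" by (simp add: algebra_simps)
  with s_nonconst have "d = 0" by simp
  with cd show "F \<in> K" by simp
next
  fix F assume "F \<in> K"
  then show "F \<in> function_field n"
    unfolding pulled_back_field_def using subst_rat_function_field[OF cover_map_homogeneous[OF n]]
    by blast
next
  fix F \<sigma> assume "F \<in> K" "\<sigma> \<in> deck_transformations n (cover_map n)"
  then show "\<sigma> F = F" by (simp add: deck_transformations_def)
qed

end

section \<open>Splitting the connection\<close>

lemma matrix_inv_mult_left:
  assumes "invertible A"
  shows "matrix_inv A ** A = mat 1"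
  using someI_ex[OF assms[unfolded invertible_def]] by (simp add: matrix_inv_def)

text \<open>Clearing the inverse of \<open>M\<close> turns a gauge computation into a matrix
  identity that can be checked entrywise.\<close>

lemma gauge_eqI:
  assumes "invertible M" and "M ** B = A j ** M + (\<chi> r c. diff (M $ r $ c) j)"
  shows "gauge M A j = B"
proof -
  have "gauge M A j = matrix_inv M ** (M ** B)"
    unfolding assms(2) gauge_def by (simp add: matrix_add_ldistrib matrix_mul_assoc)
  then show ?thesis
    by (simp add: matrix_mul_assoc matrix_inv_mult_left[OF assms(1)])
qed

lemma mat22_component [simp]:
  "mat22 p q r t $ 1 $ 1 = p" "mat22 p q r t $ 1 $ 2 = q"
  "mat22 p q r t $ 2 $ 1 = r" "mat22 p q r t $ 2 $ 2 = t"
  by (simp_all add: mat22_def)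

lemma mat22_eqI:
  assumes "A $ 1 $ 1 = p" "A $ 1 $ 2 = q" "A $ 2 $ 1 = r" "A $ 2 $ 2 = t"
  shows "A = mat22 p q r t"
  using assms by (simp add: vec_eq_iff forall_2)

text \<open>
  For a solution \<open>z\<close> of the Riccati equation of \<open>A\<close>, the function \<open>v = (y z + x - 1)/s\<close> satisfies
  \<open>dv + k s (1 - v\<^sup>2) = 0\<close>; the matrix \<open>M\<close> moves its two constant solutions \<open>v = 1\<close> and \<open>v = -1\<close> to
  \<open>\<infinity>\<close> and \<open>0\<close>.
\<close>

lemma gauge_riccati:
  fixes x y s k e g p q :: crat
  assumes y: "y \<noteq> 0" "pd j y = g * y" and s: "s \<noteq> 0" "pd j s = e * s"
    and p: "p = - (x - 1) * k - e / 2 + g / 2"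
    and q: "q * y = pd j x - (x - 1)\<^sup>2 * k - (x - 1) * e + k * s\<^sup>2"
    and A: "A j = mat22 p q (y * k) (- p)"
    and M: "M = mat22 (s - (x - 1)) (s + (x - 1)) y (- y)"
  shows "gauge M A j = mat22 (k * s + (e + g) / 2) 0 0 (- k * s + (e + g) / 2)"
proof (rule gauge_eqI)
  have "det M = - (2 * s * y)"
    by (simp add: det_2 M algebra_simps)
  with y s show "invertible M"
    by (simp add: invertible_det_nz)
  define X where "X = x - 1"
  \<comment> \<open>The four identities are the entries of M B = A M + dM. The columns of
    \<open>M\<close> represent v = 1 and v = -1. The common summand \<open>(e + g) / 2\<close> is
    half the logarithmic derivative of det M = -2sy, which the trace-free \<open>A\<close> leaves as
    the scalar part.\<close>
  have "(s - X) * (k * s + (e + g) / 2) = p * (s - X) + q * y + (e * s - pd j x)"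
    unfolding p q X_def[symmetric] by (simp add: field_simps power2_eq_square)
  moreover have "(s + X) * (- k * s + (e + g) / 2) = p * (s + X) - q * y + (e * s + pd j x)"
    unfolding p q X_def[symmetric] by (simp add: field_simps power2_eq_square)
  moreover have "y * (k * s + (e + g) / 2) = y * k * (s - X) - p * y + g * y"
    unfolding p X_def[symmetric] by (simp add: field_simps)
  moreover have "- y * (- k * s + (e + g) / 2) = y * k * (s + X) + p * y - g * y"
    unfolding p X_def[symmetric] by (simp add: field_simps)
  ultimately show "M ** mat22 (k * s + (e + g) / 2) 0 0 (- k * s + (e + g) / 2) =
      A j ** M + (\<chi> r c. diff (M $ r $ c) j)"
    unfolding A M X_def[symmetric]
    by (simp add: vec_eq_iff forall_2 matrix_matrix_mult_def sum_2 diff_def pd_add pd_diff pd_uminus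
        X_def y s)
qed

definition theta :: "nat \<Rightarrow> (nat \<Rightarrow> complex) \<Rightarrow> form" where
  "theta n lam = (\<lambda>j. alpha0 n lam j + (\<Sum>i = 1..n - 2. alpha0i n lam i j))"

text \<open>The summands for the z_i repeat the pattern of the leading matrix in alpha_0 and
  alpha_2, without the remaining terms. By linearity the sum is absorbed on replacing alpha_0 by
  theta and alpha_2 by -theta/f.\<close>

lemma nabla_eq:
  "nabla n lam j = mat22
     ((xx n - 1) * (- theta n lam j / ff n) - 1 / 4 * (diff (ff n) j / ff n)
       + 1 / 2 * (diff (yy n) j / yy n))
     ((diff (xx n) j + (xx n - 1)\<^sup>2 * (- theta n lam j / ff n)
       - 2 * (xx n - 1) * (1 / 4 * (diff (ff n) j / ff n)) + theta n lam j) / yy n)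
     (yy n * (theta n lam j / ff n))
     (- ((xx n - 1) * (- theta n lam j / ff n) - 1 / 4 * (diff (ff n) j / ff n)
       + 1 / 2 * (diff (yy n) j / yy n)))"
proof -
  define S where "S = (\<Sum>i = 1..n - 2. alpha0i n lam i j)"
  have theta: "theta n lam j = alpha0 n lam j + S"
    by (simp add: theta_def S_def)
  have S2: "(\<Sum>i = 1..n - 2. alpha2i n lam i j) = - S / ff n"
    by (simp add: alpha2i_def S_def sum_negf sum_divide_distrib)
  have S11: "(\<Sum>i = 1..n - 2. A11i n lam i j) = (xx n - 1) * (- S / ff n)"
    by (simp only: A11i_def S2 flip: sum_distrib_left)
  have S12: "(\<Sum>i = 1..n - 2. A12i n lam i j) = ((xx n - 1)\<^sup>2 * (- S / ff n) + S) / yy n"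
    by (simp only: A12i_def S2 S_def[symmetric] sum.distrib flip: sum_distrib_left sum_divide_distrib)
  have S21: "(\<Sum>i = 1..n - 2. A21i n lam i j) = yy n * (- S / ff n)"
    by (simp only: A21i_def S2 flip: sum_distrib_left)
  define U where "U = - S / ff n"
  have U: "- theta n lam j / ff n = alpha2 n lam j + U"
    by (simp add: theta alpha2_def U_def add_divide_distrib diff_divide_distrib)
  have U': "theta n lam j / ff n = - (alpha2 n lam j + U)"
    unfolding U[symmetric] by simp
  have "nabla n lam j $ 1 $ 1 = (xx n - 1) * (alpha2 n lam j + U) - 1 / 4 * (diff (ff n) j / ff n)
       + 1 / 2 * (diff (yy n) j / yy n)"
    by (simp only: nabla_def vector_add_component sum_component mat22_component S11
        A11_def alpha1_def U_def[symmetric]) (simp add: algebra_simps)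
  moreover have "nabla n lam j $ 2 $ 2 = - (nabla n lam j $ 1 $ 1)"
    by (simp add: nabla_def sum_negf)
  moreover have "nabla n lam j $ 1 $ 2 = (diff (xx n) j + (xx n - 1)\<^sup>2 * (alpha2 n lam j + U)
       - 2 * (xx n - 1) * (1 / 4 * (diff (ff n) j / ff n)) + theta n lam j) / yy n"
  proof -
    have "(dx + X * u + 2 * Y * (- (1 / 4) * t) + v) / y + (X * U + S) / y =
        (dx + X * (u + U) - 2 * Y * (1 / 4 * t) + (v + S)) / y" for dx X Y u v t y :: crat
      by (simp add: ring_distribs flip: add_divide_distrib)
    then show ?thesis
      by (simp only: nabla_def vector_add_component sum_component mat22_component S12
          A12_def alpha1_def theta U_def[symmetric])
  qed
  moreover have "nabla n lam j $ 2 $ 1 = yy n * (- (alpha2 n lam j + U))"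
    by (simp only: nabla_def vector_add_component sum_component mat22_component sum_negf S21
        A21_def U_def[symmetric]) (simp add: algebra_simps)
  ultimately show ?thesis
    unfolding U U' by (intro mat22_eqI) simp_all
qed

section \<open>Closed rational forms and logarithmic differentials\<close>

lemma pd_const_divide:
  assumes "pd i C = 0" "h \<noteq> 0"
  shows "pd i (C / h) = - (C / h\<^sup>2) * pd i h"
  using assms by (simp add: pd_divide)

lemma rational_forms_0: "(\<lambda>j. 0) \<in> rational_forms n"
  unfolding rational_forms_def by (intro CollectI exI[of _ 0]) auto

lemma rational_forms_add:
  assumes "w \<in> rational_forms n" "F \<in> function_field n" "G \<in> function_field n"
  shows "(\<lambda>j. w j + G * diff F j) \<in> rational_forms n"
proof -
  from assms(1) obtain m :: nat and a b where w: "w = (\<lambda>j. \<Sum>k<m. a k * diff (b k) j)"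
    and "\<forall>k<m. a k \<in> function_field n \<and> b k \<in> function_field n"
    unfolding rational_forms_def by blast
  with assms(2,3) show ?thesis
    unfolding rational_forms_def w
    by (intro CollectI exI[of _ "Suc m"] exI[of _ "a(m := G)"] exI[of _ "b(m := F)"])
      (auto simp: less_Suc_eq)
qed

definition closed_rational_forms :: "nat \<Rightarrow> form set" where
  "closed_rational_forms n = {w \<in> rational_forms n. closed_form w}"

lemma closed_rational_forms_0: "(\<lambda>j. 0) \<in> closed_rational_forms n"
  by (simp add: closed_rational_forms_def rational_forms_0 closed_form_def)

text \<open>The last premise says that \<open>dG\<close> is proportional to \<open>dF\<close>, so that \<open>dG \<and> dF = 0\<close>.\<close>

lemma closed_rational_forms_add:
  assumes "w \<in> closed_rational_forms n" "F \<in> function_field n" "G \<in> function_field n"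
    and "\<And>i. pd i G = g * pd i F"
  shows "(\<lambda>j. w j + G * diff F j) \<in> closed_rational_forms n"
proof -
  have "closed_form (\<lambda>j. w j + G * diff F j)" if "closed_form w"
    using that by (simp add: closed_form_def diff_def pd_add pd_mult assms(4) pd_commute
        mult.commute mult.left_commute)
  with assms(1-3) show ?thesis
    by (simp add: closed_rational_forms_def rational_forms_add)
qed

lemma closed_rational_forms_sum:
  assumes "w \<in> closed_rational_forms n" "finite I"
    and "\<And>i. i \<in> I \<Longrightarrow> F i \<in> function_field n" "\<And>i. i \<in> I \<Longrightarrow> G i \<in> function_field n"
    and "\<And>i k. i \<in> I \<Longrightarrow> pd k (G i) = g i * pd k (F i)"
  shows "(\<lambda>j. w j + (\<Sum>i\<in>I. G i * diff (F i) j)) \<in> closed_rational_forms n"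
  using assms(2-)
proof (induction I rule: finite_induct)
  case empty
  then show ?case using assms(1) by simp
next
  case (insert k I)
  then have "(\<lambda>j. (w j + (\<Sum>i\<in>I. G i * diff (F i) j)) + G k * diff (F k) j) \<in> closed_rational_forms n"
    by (intro closed_rational_forms_add[where g = "g k"] insert.IH) auto
  with insert.hyps show ?case by (simp add: add_ac)
qed

text \<open>With \<open>x = a b\<close> and \<open>y = (1 - a)(1 - b)\<close>, this writes \<open>\<alpha>\<^sub>0/(a - b)\<close> as a combination of logarithmic
  differentials.\<close>

lemma alpha0_identity:
  fixes a b da db l0 l1 x y dx dy :: "'a :: field_char_0"
  assumes "a \<noteq> 0" "b \<noteq> 0" "1 - a \<noteq> 0" "1 - b \<noteq> 0"
    and x: "x = a * b" and y: "y = (1 - a) * (1 - b)"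
    and dx: "dx = da * b + a * db" and dy: "dy = - da * (1 - b) - (1 - a) * db"
  shows "- (((2 * l0 + l1) * dx - (2 * l1 + l0) * dy) / 2)
      - l1 * (y - 1) / 2 * (dx / x) + l0 * (x - 1) / 2 * (dy / y)
    = (a - b) * (l0 / 2 / (1 - a) * da - l0 / 2 / (1 - b) * db - l1 / 2 / a * da + l1 / 2 / b * db)"
proof -
  have dxx: "dx / x = da / a + db / b"
    using assms by (simp add: add_divide_distrib)
  have dyy: "dy / y = - (da / (1 - a)) - db / (1 - b)"
    using assms by (simp add: diff_divide_distrib)
  \<comment> \<open>The claim is linear in \<open>l0\<close> and \<open>l1\<close>, and each
    coefficient is checked separately: that of \<open>l1\<close> has only the denominators a and b,
    that of \<open>l0\<close> only u and v.\<close>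
  define u v where "u = 1 - a" and "v = 1 - b"
  have ab: "a = 1 - u" "b = 1 - v" by (simp_all add: u_def v_def)
  have uv: "u \<noteq> 0" "v \<noteq> 0" using assms by (simp_all add: u_def v_def)
  have l1: "- (dx - 2 * dy) / 2 - (y - 1) / 2 * (da / a + db / b) = (a - b) * (- (da / a) + db / b) / 2"
    using assms(1,2) by (simp add: x y dx dy field_simps)
  have l0: "- (2 * dx - dy) / 2 + (x - 1) / 2 * (- (da / u) - db / v) = (a - b) * (da / u - db / v) / 2"
    using uv by (simp add: x y dx dy ab field_simps)
  have split: "- (((2 * l0 + l1) * dx - (2 * l1 + l0) * dy) / 2)
      - l1 * (y - 1) / 2 * X + l0 * (x - 1) / 2 * Y
    = l0 * (- (2 * dx - dy) / 2 + (x - 1) / 2 * Y) + l1 * (- (dx - 2 * dy) / 2 - (y - 1) / 2 * X)" for X Y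
    by (simp add: field_simps)
  have collect: "l0 * ((a - b) * (p - q) / 2) + l1 * ((a - b) * (- P + Q) / 2)
    = (a - b) * (l0 / 2 * p - l0 / 2 * q - l1 / 2 * P + l1 / 2 * Q)" for p q P Q
    by (simp add: field_simps)
  have assoc: "l / 2 / v * d = l / 2 * (d / v)" for l v d :: 'a by simp
  show ?thesis
    by (simp only: dxx dyy u_def[symmetric] v_def[symmetric] split l0 l1 collect assoc)
qed

text \<open>For r = z/s the right side is s times l dr/(1 - r^2). Both sides equal l s (s dz - z
  ds)/(s^2 - z^2).\<close>

lemma alpha0i_identity:
  fixes s z ds dz l :: "'a :: field_char_0"
  assumes "s \<noteq> 0" "s\<^sup>2 - z\<^sup>2 \<noteq> 0"
  shows "l * (dz - z * (2 * s * ds - 2 * z * dz) / (2 * (s\<^sup>2 - z\<^sup>2)))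
    = s * (l / (1 - (z / s)\<^sup>2) * ((dz * s - z * ds) / s\<^sup>2))"
proof -
  define h where "h = s\<^sup>2 - z\<^sup>2"
  have "1 - (z / s)\<^sup>2 = h / s\<^sup>2"
    using assms by (simp add: h_def power_divide field_simps)
  moreover have "dz - z * (2 * s * ds - 2 * z * dz) / (2 * h) = s * (dz * s - z * ds) / h"
  proof -
    have "z * (2 * s * ds - 2 * z * dz) / (2 * h) = z * (s * ds - z * dz) / h"
      using assms by (simp add: h_def field_simps)
    moreover have "dz = dz * (s\<^sup>2 - z\<^sup>2) / h" using assms by (simp add: h_def)
    ultimately have "dz - z * (2 * s * ds - 2 * z * dz) / (2 * h) =
        (dz * (s\<^sup>2 - z\<^sup>2) - z * (s * ds - z * dz)) / h"
      by (metis diff_divide_distrib)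
    then show ?thesis by (simp add: power2_eq_square algebra_simps)
  qed
  moreover have "l * (s * N / h) = s * (l / (h / s\<^sup>2) * (N / s\<^sup>2))" for N
    using assms by (simp add: h_def)
  ultimately show ?thesis
    by (simp only: h_def[symmetric])
qed

section \<open>The pulled-back connection and its splitting form\<close>

context double_cover
begin

lemma pulls_back_coords: "pulls_back n (xx n)" "pulls_back n (yy n)" "pulls_back n (ff n)"
  using n unfolding quad_def xx_def yy_def by (intro pulls_back_intros; simp)+

lemma pulls_back_zz: "i \<le> n - 2 \<Longrightarrow> pulls_back n (zz n i)"
  using n unfolding zz_def by (intro pulls_back_intros) auto

abbreviation x' :: crat where "x' \<equiv> a * b"
abbreviation y' :: crat where "y' \<equiv> (1 - a) * (1 - b)"

lemma ab_nonzero: "a \<noteq> 0" "b \<noteq> 0" "1 - a \<noteq> 0" "1 - b \<noteq> 0"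
proof -
  show "a \<noteq> 0" "b \<noteq> 0" by (simp_all add: a_def b_def)
  have "pd 0 a = 1 / rvar n" "pd 1 b = 1 / rvar n"
    using n by (simp_all add: a_def b_def pd_simps pd_rvar power2_eq_square)
  then show "1 - a \<noteq> 0" "1 - b \<noteq> 0" by auto
qed

definition omega :: "(nat \<Rightarrow> complex) \<Rightarrow> form" where
  "omega lam = (\<lambda>j. pullback_form n (cover_map n) (theta n lam) j / s)"

text \<open>z_i does not involve X_0, so the derivative by X_0 is 2s/X_n, which is nonzero.\<close>

lemma s_sq_minus_zz_sq:
  assumes "1 \<le> i" "i \<le> n - 2"
  shows "s\<^sup>2 - (zz n i)\<^sup>2 \<noteq> 0"
proof
  assume "s\<^sup>2 - (zz n i)\<^sup>2 = 0"
  then have "pd 0 (s\<^sup>2 - (zz n i)\<^sup>2) = 0" by simp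
  moreover have "pd 0 (zz n i) = 0"
    using assms n by (simp add: zz_def pd_simps pd_rvar)
  ultimately have "2 * s * pd 0 s = 0" by (simp add: pd_simps)
  then show False using s_nonconst by (simp add: pd_0_s)
qed

text \<open>The leading 0 and the signs moved into the coefficients give the shape
  \<open>w j + G * diff F j\<close> to which the closure rules for closed rational forms apply one
  term at a time.\<close>

lemma omega_eq:
  "omega lam = (\<lambda>j. 0 + rconst (lam 0) / 2 / (1 - a) * diff a j
     + (- (rconst (lam 0) / 2 / (1 - b))) * diff b j
     + (- (rconst (lam 1) / 2 / a)) * diff a j
     + rconst (lam 1) / 2 / b * diff b j
     + (\<Sum>i = 1..n - 2. rconst (lam (i + 1)) / (1 - (zz n i / s)\<^sup>2) * diff (zz n i / s) j))"
proof
  fix j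
  let ?P = "pullback_form n (cover_map n)"
  have "?P (alpha0 n lam) j = - (((2 * rconst (lam 0) + rconst (lam 1)) * diff x' j
         - (2 * rconst (lam 1) + rconst (lam 0)) * diff y' j) / 2)
     - rconst (lam 1) * (y' - 1) / 2 * (diff x' j / x')
     + rconst (lam 0) * (x' - 1) / 2 * (diff y' j / y')"
    unfolding alpha0_def
    by (simp add: pullback_form_simps pulls_backD[OF pulls_back_coords(1)]
        pulls_backD[OF pulls_back_coords(2)] subst_rat_simps subst_rat_xx subst_rat_yy)
  also have "\<dots> = s * (rconst (lam 0) / 2 / (1 - a) * diff a j - rconst (lam 0) / 2 / (1 - b) * diff b j
       - rconst (lam 1) / 2 / a * diff a j + rconst (lam 1) / 2 / b * diff b j)"
    unfolding s_def
    by (rule alpha0_identity[OF ab_nonzero refl refl]) (simp_all add: diff_def pd_simps)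
  finally have alpha0: "?P (alpha0 n lam) j = \<dots>" .
  have alpha0i: "?P (alpha0i n lam i) j =
      s * (rconst (lam (i + 1)) / (1 - (zz n i / s)\<^sup>2) * diff (zz n i / s) j)"
    if i: "i \<in> {1..n - 2}" for i
  proof -
    have pb: "pulls_back n (ff n - (zz n i)\<^sup>2)" "pulls_back n (zz n i)"
      using i by (auto intro!: pulls_back_intros pulls_back_coords pulls_back_zz)
    have zz: "subst_rat (cover_map n) (zz n i) = zz n i"
      using i by (simp add: subst_rat_zz)
    have ff: "subst_rat (cover_map n) (ff n - (zz n i)\<^sup>2) = s\<^sup>2 - (zz n i)\<^sup>2"
      by (simp only: subst_rat_diff subst_rat_power zz subst_rat_ff)
    have "?P (alpha0i n lam i) j = rconst (lam (i + 1)) *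
       (diff (zz n i) j - zz n i * diff (s\<^sup>2 - (zz n i)\<^sup>2) j / (2 * (s\<^sup>2 - (zz n i)\<^sup>2)))"
      unfolding alpha0i_def
      by (simp only: pullback_form_simps pulls_backD[OF pb(1)] pulls_backD[OF pb(2)]
          subst_rat_mult subst_rat_numeral subst_rat_rconst zz ff)
    also have "\<dots> = rconst (lam (i + 1)) * (diff (zz n i) j
        - zz n i * (2 * s * diff s j - 2 * zz n i * diff (zz n i) j) / (2 * (s\<^sup>2 - (zz n i)\<^sup>2)))"
      by (simp add: diff_def pd_simps)
    also have "\<dots> = s * (rconst (lam (i + 1)) / (1 - (zz n i / s)\<^sup>2) * diff (zz n i / s) j)"
      using i s_nonconst s_sq_minus_zz_sq[of i]
      by (subst alpha0i_identity) (simp_all add: diff_def pd_divide)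
    finally show ?thesis .
  qed
  have "?P (theta n lam) j = ?P (alpha0 n lam) j + (\<Sum>i = 1..n - 2. ?P (alpha0i n lam i) j)"
    unfolding theta_def by (simp add: pullback_form_add pullback_form_sum)
  also have "\<dots> = s * (rconst (lam 0) / 2 / (1 - a) * diff a j - rconst (lam 0) / 2 / (1 - b) * diff b j
       - rconst (lam 1) / 2 / a * diff a j + rconst (lam 1) / 2 / b * diff b j
       + (\<Sum>i = 1..n - 2. rconst (lam (i + 1)) / (1 - (zz n i / s)\<^sup>2) * diff (zz n i / s) j))"
    using alpha0i by (simp only: alpha0 sum_distrib_left distrib_left cong: sum.cong)
  finally show "omega lam j = 0 + rconst (lam 0) / 2 / (1 - a) * diff a j
     + (- (rconst (lam 0) / 2 / (1 - b))) * diff b j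
     + (- (rconst (lam 1) / 2 / a)) * diff a j
     + rconst (lam 1) / 2 / b * diff b j
     + (\<Sum>i = 1..n - 2. rconst (lam (i + 1)) / (1 - (zz n i / s)\<^sup>2) * diff (zz n i / s) j)"
    using s_nonconst(1) by (simp add: omega_def)
qed

lemma function_field_coords:
  "a \<in> function_field n" "b \<in> function_field n" "s \<in> function_field n"
  using n by (simp_all add: s_def a_def b_def function_field_intros)

lemma function_field_zz: "i \<le> n - 2 \<Longrightarrow> zz n i \<in> function_field n"
  using n by (simp add: zz_def function_field_ratio)

text \<open>In every term G dF the coefficient G is a rational expression in F alone, so dG is a
  multiple of dF. The multipliers below are the derivatives of G by F.\<close>

lemma omega_closed_rational: "omega lam \<in> closed_rational_forms n"
proof -
  have nonzero: "1 - (zz n i / s)\<^sup>2 \<noteq> 0" if "i \<in> {1..n - 2}" for i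
    using that s_sq_minus_zz_sq[of i] s_nonconst by (simp add: power_divide field_simps)
  show ?thesis
    unfolding omega_eq
  proof (intro closed_rational_forms_sum closed_rational_forms_add closed_rational_forms_0)
    fix i
    have const: "pd i (rconst c / 2) = 0" for c
      by (simp add: pd_divide)
    show "pd i (rconst (lam 0) / 2 / (1 - a)) = rconst (lam 0) / 2 / (1 - a)\<^sup>2 * pd i a"
      unfolding pd_const_divide[OF const ab_nonzero(3)] by (simp add: pd_diff)
    show "pd i (- (rconst (lam 0) / 2 / (1 - b))) = - (rconst (lam 0) / 2 / (1 - b)\<^sup>2) * pd i b"
      unfolding pd_uminus pd_const_divide[OF const ab_nonzero(4)] by (simp add: pd_diff)
    show "pd i (- (rconst (lam 1) / 2 / a)) = rconst (lam 1) / 2 / a\<^sup>2 * pd i a"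
      unfolding pd_uminus pd_const_divide[OF const ab_nonzero(1)] by simp
    show "pd i (rconst (lam 1) / 2 / b) = - (rconst (lam 1) / 2 / b\<^sup>2) * pd i b"
      unfolding pd_const_divide[OF const ab_nonzero(2)] by simp
  next
    fix i k assume i: "i \<in> {1..n - 2}"
    define r where "r = zz n i / s"
    have "pd k (rconst (lam (i + 1)) / (1 - r\<^sup>2)) =
        rconst (lam (i + 1)) * 2 * r / (1 - r\<^sup>2)\<^sup>2 * pd k r"
      using nonzero[OF i] unfolding r_def[symmetric]
      by (subst pd_const_divide) (simp_all add: pd_diff pd_power2)
    then show "pd k (rconst (lam (i + 1)) / (1 - (zz n i / s)\<^sup>2)) =
        rconst (lam (i + 1)) * 2 * (zz n i / s) / (1 - (zz n i / s)\<^sup>2)\<^sup>2 * pd k (zz n i / s)"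
      by (simp only: r_def)
  qed (auto simp: power2_eq_square intro!: function_field_intros function_field_coords function_field_zz)
qed

text \<open>This is \<open>gauge_riccati\<close> at x = ab, y = (1 - a)(1 - b), with k s equal to
  \<open>omega\<close> and with e, g the logarithmic derivatives of s and y.\<close>

lemma equivalent_to_split:
  "projectively_birationally_equivalent n
     (pullback_connection n (cover_map n) (nabla n lam)) (split_connection (omega lam))"
proof -
  let ?P = "pullback_form n (cover_map n)"
  define T where "T = ?P (theta n lam)"
  define M where "M = mat22 (s - (x' - 1)) (s + (x' - 1)) y' (- y')"
  have y: "y' \<noteq> 0" using ab_nonzero by simp
  have conn: "pullback_connection n (cover_map n) (nabla n lam) j = mat22
      ((x' - 1) * (- T j / s\<^sup>2) - 1 / 4 * (pd j (s\<^sup>2) / s\<^sup>2) + 1 / 2 * (pd j y' / y'))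
      ((pd j x' + (x' - 1)\<^sup>2 * (- T j / s\<^sup>2) - 2 * (x' - 1) * (1 / 4 * (pd j (s\<^sup>2) / s\<^sup>2)) + T j) / y')
      (y' * (T j / s\<^sup>2))
      (- ((x' - 1) * (- T j / s\<^sup>2) - 1 / 4 * (pd j (s\<^sup>2) / s\<^sup>2) + 1 / 2 * (pd j y' / y')))" for j
    by (rule mat22_eqI, simp_all only: pullback_connection_def nabla_eq mat22_component vec_lambda_beta
        pullback_form_simps pulls_back_coords[THEN pulls_backD] subst_rat_simps
        subst_rat_xx subst_rat_yy subst_rat_ff T_def[symmetric], simp_all only: diff_def)
  have gauge: "gauge M (pullback_connection n (cover_map n) (nabla n lam)) j =
      mat22 (T j / s\<^sup>2 * s + (pd j s / s + pd j y' / y') / 2) 0 0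
        (- (T j / s\<^sup>2) * s + (pd j s / s + pd j y' / y') / 2)" for j
  proof (rule gauge_riccati[where x = x' and j = j
        and A = "pullback_connection n (cover_map n) (nabla n lam)", OF y _ s_nonconst(1) _ _ _ conn[of j] M_def])
    have ds: "1 / 4 * (pd j (s\<^sup>2) / s\<^sup>2) = pd j s / s / 2"
      unfolding pd_power2 using s_nonconst by (simp add: power2_eq_square)
    show "(x' - 1) * (- T j / s\<^sup>2) - 1 / 4 * (pd j (s\<^sup>2) / s\<^sup>2) + 1 / 2 * (pd j y' / y') =
        - (x' - 1) * (T j / s\<^sup>2) - pd j s / s / 2 + pd j y' / y' / 2"
    proof -
      have "X * (- t / w) - e + 1 / 2 * g = - X * (t / w) - e + g / 2" for X t w e g :: crat
        by simp
      then show ?thesis unfolding ds .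
    qed
    show "(pd j x' + (x' - 1)\<^sup>2 * (- T j / s\<^sup>2) - 2 * (x' - 1) * (1 / 4 * (pd j (s\<^sup>2) / s\<^sup>2)) + T j) / y' * y' =
        pd j x' - (x' - 1)\<^sup>2 * (T j / s\<^sup>2) - (x' - 1) * (pd j s / s) + T j / s\<^sup>2 * s\<^sup>2"
    proof -
      have "(dx + X\<^sup>2 * (- t / w) - 2 * X * (e / 2) + t) / v * v = dx - X\<^sup>2 * (t / w) - X * e + t / w * w"
        if "v \<noteq> 0" "w \<noteq> 0" for dx X t w e v :: crat
        using that by simp
      note this[OF y, of "s\<^sup>2"]
      then show ?thesis
        unfolding ds using s_nonconst(1) by (simp only: power_not_zero not_False_eq_True)
    qed
  qed (use y s_nonconst in simp_all)
  have omega: "T j / s\<^sup>2 * s = omega lam j" for j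
    using s_nonconst by (simp add: omega_def T_def power2_eq_square)
  have "det M = - (2 * s * y')"
    by (simp add: det_2 M_def algebra_simps)
  with y s_nonconst have "invertible M"
    by (simp add: invertible_det_nz)
  moreover have "\<forall>r c. M $ r $ c \<in> function_field n"
    by (simp add: forall_2 M_def function_field_intros function_field_coords)
  \<comment> \<open>Only the difference of the diagonal entries matters; the common scalar term
    cancels and leaves twice \<open>omega\<close>.\<close>
  moreover have "projective_connection (gauge M (pullback_connection n (cover_map n) (nabla n lam))) =
      projective_connection (split_connection (omega lam))"
    by (simp add: projective_connection_def split_connection_def gauge flip: omega)
  ultimately show ?thesis
    unfolding projectively_birationally_equivalent_def by blast
qed

end

theorem theorem1p2:
  fixes n :: nat
  assumes "n \<ge> 2"
  shows "\<exists>G. rational_map n G \<and> generically_finite n G \<and> galois_map n G \<and>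
    (\<forall>lam :: nat \<Rightarrow> complex. \<exists>w\<in>rational_forms n. closed_form w \<and>
      projectively_birationally_equivalent n
        (pullback_connection n G (nabla n lam)) (split_connection w))"
proof -
  interpret double_cover n by unfold_locales (rule assms)
  show ?thesis
    \<comment> \<open>The witness \<open>cover_map n\<close> does not depend on \<open>lam\<close>;
      only the form \<open>omega lam\<close> does.\<close>
    using rational_map_cover generically_finite_cover galois_map_cover equivalent_to_split
      omega_closed_rational
    unfolding closed_rational_forms_def by blast
qed

end
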